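(* Let $B$ be a translation invariant random matrix with entries in $\{0\}\cup[1,\infty)$, let $\{B_n\}_{n\in\mathbb{N}^*}$ be independent copies of $B$, and let $\{M_n\}_{n\in\mathbb{N}}$ be the associated process started from a unit mass at the origin. (First part.) Suppose that there exist $\delta>0$ and $m\in\mathbb{N}^*$ such that $c_\delta(\prod_{k=1}^mB_k)>0$. Then for each $\epsilon$ with $0<\epsilon<\delta$ there exists a random path $\{\Gamma(n)\}_{n\in\mathbb{N}}$ in $\mathbb{Z}^d$ such that, almost surely on $\{|M_n|\ge1\text{ for all }n\in\mathbb{N}\}$, the path $\Gamma$ is open and $$\liminf_{n\to\infty}\frac1n\log M_{n,\Gamma(n)}\ \ge\ \frac1m\,c_{\delta-\epsilon}\Big(\prod_{k=1}^mB_k\Big)\log(1+\delta-\epsilon).$$ In particular, $$\liminf_{n\to\infty}\frac1n\log|M_n|\ \ge\ \frac1m\,c_\delta\Big(\prod_{k=1}^mB_k\Big)\log(1+\delta)$$ almost surely on $\{|M_n|\ge1\text{ for all }n\in\mathbb{N}\}$. (Second part.) Suppose on the other hand that $c_\delta(\prod_{k=1}^mB_k)=0$ for all $\delta>0$ and all $m\in\mathbb{N}^*$, and that there exists $r_B>0$ such that $B_{x,y}=0$ whenever $|x-y|\ge r_B$. Then $$\limsup_{n\to\infty}\frac1n\log|M_n|\le0$$ almost surely, with the convention $\log0=-\infty$.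
   Context: $\mathbb{N}=\{0,1,2,\dots\}$, $\mathbb{N}^*=\mathbb{N}\setminus\{0\}$, and $o$ is the origin of $\mathbb{Z}^d$; $|x-y|$ for $x,y\in\mathbb{Z}^d$ is the distance in a fixed norm. $B=(B_{x,y})_{x,y\in\mathbb{Z}^d}$ is a random matrix with entries in $\{0\}\cup[1,\infty)$; translation invariant means that $(B_{x+z,y+z})_{x,y}$ has the same law as $(B_{x,y})_{x,y}$ for every $z\in\mathbb{Z}^d$. No independence between entries is assumed. With independent copies $B_n=(B_{n,x,y})_{x,y\in\mathbb{Z}^d}$, $n\in\mathbb{N}^*$, the $[0,\infty]^{\mathbb{Z}^d}$-valued process $M_n=(M_{n,x})_{x\in\mathbb{Z}^d}$ is defined by $$M_{0,x}=\delta_{o,x},\qquad M_{n,x}=\sum_{y\in\mathbb{Z}^d}M_{n-1,y}B_{n,y,x}\quad(n\in\mathbb{N}^* ),$$ where $\delta_{o,x}$ is the Kronecker delta and $\infty\cdot0=0$. The total mass is $|M_n|=\sum_xM_{n,x}$ (with $\log\infty=\infty$). A sequence $\{\Gamma(n)\}_{n\in\mathbb{N}}\subset\mathbb{Z}^d$ is an open path if $B_{n+1,\Gamma(n),\Gamma(n+1)}\ge1$ for all $n\in\mathbb{N}$. $\prod_{k=1}^mB_k$ denotes the matrix product $B_1\cdots B_m$ (its entries may take the value $+\infty$). For $\delta>0$ and a translation invariant random matrix $D$ with entries in $\{0\}\cup[1,\infty]$, $$c_\delta(D)=P\big(|M^D_n|\ge1\text{ for all }n\in\mathbb{N}\big)\,\sup_{x\in\mathbb{Z}^d}P(D_{o,x}\ge1+\delta),$$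 where $M^D$ is the process defined as $M$ above, but with independent copies of $D$ in place of the $B_n$. For $D=\prod_{k=1}^mB_k$ the process $M^D$ has the law of $\{M_{mn}\}_{n\in\mathbb{N}}$, so the first factor equals $P(|M_n|\ge1\text{ for all }n\in\mathbb{N})$. *)

theory Defs
  imports "HOL-Probability.Probability"
begin

type_synonym 'd lattice = "int ^ 'd"

text \<open>Matrices indexed by the lattice; the entry of \<open>b\<close> in row \<open>x\<close> and column \<open>y\<close> is \<open>b (x, y)\<close>.
  Entries live in \<open>ennreal\<close> because products of matrices may have infinite entries; there
  \<open>\<infinity> * 0 = 0\<close>.\<close>

type_synonym 'd lmatrix = "'d lattice \<times> 'd lattice \<Rightarrow> ennreal"

definition matrix_space :: "('d::finite) lmatrix measure" where
  "matrix_space = (\<Pi>\<^sub>M p\<in>UNIV. borel)"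

definition translate :: "('d::finite) lattice \<Rightarrow> 'd lmatrix \<Rightarrow> 'd lmatrix" where
  "translate z b = (\<lambda>(x, y). b (x + z, y + z))"

definition translation_invariant :: "'v measure \<Rightarrow> ('v \<Rightarrow> ('d::finite) lmatrix) \<Rightarrow> bool" where
  "translation_invariant Q B \<longleftrightarrow>
     (\<forall>z. distr Q matrix_space (\<lambda>\<omega>. translate z (B \<omega>)) = distr Q matrix_space B)"

text \<open>Sums over the countable lattice are integrals with respect to counting measure.\<close>

definition mat_mult :: "('d::finite) lmatrix \<Rightarrow> 'd lmatrix \<Rightarrow> 'd lmatrix" where
  "mat_mult a b = (\<lambda>(x, z). \<integral>\<^sup>+ y. a (x, y) * b (y, z) \<partial>count_space UNIV)"

text \<open>\<open>mat_prod b m\<close> is the ordered product \<open>b 1 \<cdots> b m\<close>; the value \<open>b 0\<close> is never used.\<close>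

primrec mat_prod :: "(nat \<Rightarrow> ('d::finite) lmatrix) \<Rightarrow> nat \<Rightarrow> 'd lmatrix" where
  "mat_prod b 0 = (\<lambda>(x, y). if x = y then 1 else 0)"
| "mat_prod b (Suc m) = mat_mult (mat_prod b m) (b (Suc m))"

primrec mass :: "(nat \<Rightarrow> ('d::finite) lmatrix) \<Rightarrow> nat \<Rightarrow> 'd lattice \<Rightarrow> ennreal" where
  "mass b 0 = (\<lambda>x. if x = 0 then 1 else 0)"
| "mass b (Suc n) = (\<lambda>x. \<integral>\<^sup>+ y. mass b n y * b (Suc n) (y, x) \<partial>count_space UNIV)"

definition total_mass :: "(nat \<Rightarrow> ('d::finite) lmatrix) \<Rightarrow> nat \<Rightarrow> ennreal" where
  "total_mass b n = (\<integral>\<^sup>+ x. mass b n x \<partial>count_space UNIV)"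

definition survives :: "(nat \<Rightarrow> ('d::finite) lmatrix) \<Rightarrow> bool" where
  "survives b \<longleftrightarrow> (\<forall>n. 1 \<le> total_mass b n)"

definition open_path :: "(nat \<Rightarrow> ('d::finite) lmatrix) \<Rightarrow> (nat \<Rightarrow> 'd lattice) \<Rightarrow> bool" where
  "open_path b \<gamma> \<longleftrightarrow> (\<forall>n. 1 \<le> b (Suc n) (\<gamma> n, \<gamma> (Suc n)))"

text \<open>\<open>c_delta \<delta> \<nu>\<close> is \<open>c\<^sub>\<delta>(D)\<close> for a random matrix \<open>D\<close> with law \<open>\<nu>\<close>. The independent copies of
  \<open>D\<close> driving the process \<open>M\<^sup>D\<close> are the coordinates of the product space over \<open>{1..}\<close>.\<close>

definition c_delta :: "real \<Rightarrow> ('d::finite) lmatrix measure \<Rightarrow> real" where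
  "c_delta \<delta> \<nu> =
     measure (\<Pi>\<^sub>M n\<in>{1..}. \<nu>) {b \<in> space (\<Pi>\<^sub>M n\<in>{1..}. \<nu>). survives b} *
     (SUP x. measure \<nu> {D \<in> space \<nu>. ennreal (1 + \<delta>) \<le> D (0, x)})"

definition prod_law :: "'w measure \<Rightarrow> (nat \<Rightarrow> 'w \<Rightarrow> ('d::finite) lmatrix) \<Rightarrow> nat \<Rightarrow> 'd lmatrix measure" where
  "prod_law P Bs m = distr P matrix_space (\<lambda>\<omega>. mat_prod (\<lambda>n. Bs n \<omega>) m)"

definition log_ennreal :: "ennreal \<Rightarrow> ereal" where
  "log_ennreal a = (if a = 0 then - \<infinity> else if a = \<infinity> then \<infinity> else ereal (ln (enn2real a)))"

definition norm_on_Rd :: "(real ^ ('d::finite) \<Rightarrow> real) \<Rightarrow> bool" where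
  "norm_on_Rd N \<longleftrightarrow>
     (\<forall>u. N u = 0 \<longleftrightarrow> u = 0) \<and>
     (\<forall>a u. N (a *\<^sub>R u) = \<bar>a\<bar> * N u) \<and>
     (\<forall>u v. N (u + v) \<le> N u + N v)"

definition lattice_dist :: "(real ^ ('d::finite) \<Rightarrow> real) \<Rightarrow> 'd lattice \<Rightarrow> 'd lattice \<Rightarrow> real" where
  "lattice_dist N x y = N (\<chi> i. real_of_int (x $ i - y $ i))"

end

theory Submission
  imports Defs
begin

text \<open>Group the matrices into blocks of length \<open>m\<close>. Order the open paths of length \<open>k\<close> of the block
  process lexicographically, so that a step of weight at least \<open>1 + \<delta>\<close> is preferred whenever there
  is one, and let \<open>l k\<close> be the endpoint of the leftmost path of length \<open>k\<close>. It is determined by the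
  past, so the environment seen from it is a fresh copy of the initial one and \<open>l k\<close> survives with
  the full survival probability \<open>p\<close>. The times at which \<open>l k\<close> survives are renewal times: they lie on
  the leftmost infinite path \<open>\<Gamma>\<close>, given survival their mean gap is at most \<open>1 / p\<close>, and each of them is
  followed by a heavy step to a surviving site with conditional probability at least
  \<open>sup\<^sub>x P(D\<^sub>o\<^sub>,\<^sub>x \<ge> 1 + \<delta>)\<close>. A maximal ergodic argument applied to the shift to the next renewal
  shows that heavy steps have lower density at least \<open>c\<^sub>\<delta>\<close> along \<open>\<Gamma>\<close>. That \<open>\<Gamma>\<close> exists almost surely on
  survival, although vertices may have infinitely many children, is a zero-one argument.

  In the second part either the process dies out, or all entries of all products are at most \<open>1\<close>, and
  then the total mass is at most the number of sites in a box of side linear in \<open>n\<close>.\<close>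

section \<open>Leftmost paths and renewal times\<close>

text \<open>The obstacle is that picking a surviving child looks into the future: the environment
  seen from a vertex picked that way is no longer a fresh copy. Leftmost paths of finite length look
  only at the past, but their endpoints may jump to another branch when a branch dies out. The
  lexicographic order reconciles the two: an endpoint that survives is never abandoned by longer
  leftmost paths, so past and future separate exactly at the renewals.

  The form of \<open>c_delta\<close> is a quotient of two renewal quantities: a heavy step has
  probability q per renewal, the mean gap is at most 1 / p, so heavy steps occur at rate at least p
  * q per block. The gap is bounded by locating the last renewal before a fixed time. For the rate,
  only an upper bound on \<alpha> times elapsed time minus the number of heavy steps matters, for
  each \<alpha> < p * q; this needs the invariance of the conditioned law under one renewal and the
  independence of that renewal from what follows it.\<close>

definition seen_from :: "nat \<Rightarrow> ('d::finite) lattice \<Rightarrow> (nat \<Rightarrow> 'd lmatrix) \<Rightarrow> nat \<Rightarrow> 'd lmatrix" where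
  "seen_from k x b = (\<lambda>n. translate x (b (n + k)))"

lemma seen_from_seen_from: "seen_from j y (seen_from k x b) = seen_from (k + j) (x + y) b"
  by (auto simp: seen_from_def translate_def fun_eq_iff ac_simps)

lemma seen_from_0 [simp]: "seen_from 0 0 b = b"
  by (auto simp: seen_from_def translate_def fun_eq_iff)

lemma seen_from_apply: "seen_from k x b n (u, v) = b (n + k) (u + x, v + x)"
  by (simp add: seen_from_def translate_def)

text \<open>Here the matrix of the first step is \<open>b 0\<close>, whereas \<open>mass\<close> and \<open>survives\<close> start from \<open>b 1\<close>.\<close>

primrec alive :: "nat \<Rightarrow> (nat \<Rightarrow> ('d::finite) lmatrix) \<Rightarrow> bool" where
  "alive 0 b \<longleftrightarrow> True"
| "alive (Suc k) b \<longleftrightarrow> (\<exists>y. 1 \<le> b 0 (0, y) \<and> alive k (seen_from (Suc 0) y b))"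

text \<open>Survival to every finite depth. A vertex may have infinitely many children, so this does
  not by itself provide an infinite open path.\<close>

definition surv :: "(nat \<Rightarrow> ('d::finite) lmatrix) \<Rightarrow> bool" where
  "surv b \<longleftrightarrow> (\<forall>k. alive k b)"

lemma alive_Suc_imp: "alive (Suc k) b \<Longrightarrow> alive k b"
proof (induction k arbitrary: b)
  case (Suc k)
  then show ?case by (subst alive.simps) (metis alive.simps(2))
qed simp

lemma alive_mono: "j \<le> k \<Longrightarrow> alive k b \<Longrightarrow> alive j b"
  by (induction k rule: dec_induct) (simp_all add: alive_Suc_imp del: alive.simps)

lemma alive_cong: "(\<And>n. n < k \<Longrightarrow> b n = b' n) \<Longrightarrow> alive k b = alive k b'"
proof (induction k arbitrary: b b')
  case (Suc k)
  have "alive k (seen_from (Suc 0) y b) = alive k (seen_from (Suc 0) y b')" for y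
    by (rule Suc.IH) (simp add: seen_from_def Suc.prems)
  with Suc.prems[of 0] show ?case by simp
qed simp

lemma surv_imp_alive: "surv b \<Longrightarrow> alive k b"
  by (simp add: surv_def)

text \<open>The lattice is enumerated with the first site carrying an entry of size at least \<open>t\<close> moved to
  the front, so that a leftmost path takes a step of weight at least \<open>t\<close> whenever it can. If there is no such
  site, position \<open>0\<close> holds an arbitrary one, which is harmless since every site also occurs later.\<close>

definition site :: "ennreal \<Rightarrow> ('d::finite) lmatrix \<Rightarrow> nat \<Rightarrow> 'd lattice" where
  "site t a r = (case r of 0 \<Rightarrow> from_nat (LEAST i. t \<le> a (0, from_nat i)) | Suc i \<Rightarrow> from_nat i)"

lemma site_surj: "\<exists>r. site t a r = y"
  by (rule exI[of _ "Suc (to_nat y)"]) (simp add: site_def)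

lemma site_0: "t \<le> a (0, y) \<Longrightarrow> t \<le> a (0, site t a 0)"
  unfolding site_def nat.case by (rule LeastI[of _ "to_nat y"]) simp

text \<open>The predicate \<open>U\<close> is a parameter so that "has descendants at depth k" and
  "survives forever" select along the same order of the children.\<close>

definition child :: "ennreal \<Rightarrow> ('d::finite) lmatrix \<Rightarrow> ('d lattice \<Rightarrow> bool) \<Rightarrow> 'd lattice" where
  "child t a U = site t a (LEAST r. 1 \<le> a (0, site t a r) \<and> U (site t a r))"

lemma childI:
  assumes "1 \<le> a (0, y)" "U y"
  shows "1 \<le> a (0, child t a U)" "U (child t a U)"
proof -
  obtain r where "site t a r = y"
    using site_surj by blast
  with assms have "1 \<le> a (0, site t a r) \<and> U (site t a r)" by simp
  from LeastI[of "\<lambda>r. 1 \<le> a (0, site t a r) \<and> U (site t a r)", OF this]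
  show "1 \<le> a (0, child t a U)" "U (child t a U)"
    by (auto simp: child_def)
qed

text \<open>The first element of a set stays first in every subset that contains it. All
  compatibility between leftmost paths of different lengths, finite or infinite, comes from
  this.\<close>

lemma child_subset:
  assumes "\<And>y. U' y \<Longrightarrow> U y" "1 \<le> a (0, child t a U)" "U' (child t a U)"
  shows "child t a U' = child t a U"
proof -
  let ?r = "LEAST r. 1 \<le> a (0, site t a r) \<and> U (site t a r)"
  have "(LEAST r. 1 \<le> a (0, site t a r) \<and> U' (site t a r)) = ?r"
    using assms unfolding child_def
    by (intro Least_equality) (auto intro: Least_le)
  then show ?thesis by (simp add: child_def)
qed

lemma child_heavy:
  assumes "1 \<le> t" "t \<le> a (0, y)" "U (site t a 0)"
  shows "child t a U = site t a 0"
proof -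
  have "t \<le> a (0, site t a 0)" using assms(2) by (rule site_0)
  then have "(LEAST r. 1 \<le> a (0, site t a r) \<and> U (site t a r)) = 0"
    using assms by (intro Least_equality) auto
  then show ?thesis by (simp add: child_def)
qed

text \<open>Only the endpoint is recorded. When generation \<open>k\<close> is empty the value is
  arbitrary, but still a function of the first \<open>k\<close> matrices, so
  \<open>leftmost_cong\<close> needs no survival hypothesis.\<close>

primrec leftmost :: "ennreal \<Rightarrow> nat \<Rightarrow> (nat \<Rightarrow> ('d::finite) lmatrix) \<Rightarrow> 'd lattice" where
  "leftmost t 0 b = 0"
| "leftmost t (Suc k) b =
    (let y = child t (b 0) (\<lambda>y. alive k (seen_from (Suc 0) y b)) in y + leftmost t k (seen_from (Suc 0) y b))"

definition env_at :: "ennreal \<Rightarrow> nat \<Rightarrow> (nat \<Rightarrow> ('d::finite) lmatrix) \<Rightarrow> nat \<Rightarrow> 'd lmatrix" where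
  "env_at t k b = seen_from k (leftmost t k b) b"

lemma env_at_0 [simp]: "env_at t 0 b = b"
  by (simp add: env_at_def)

lemma env_at_Suc:
  "env_at t (Suc k) b = env_at t k (seen_from (Suc 0) (child t (b 0) (\<lambda>y. alive k (seen_from (Suc 0) y b))) b)"
  by (simp add: env_at_def Let_def seen_from_seen_from)

lemma alive_child:
  fixes t :: ennreal
  assumes "alive (Suc k) b"
  defines "y \<equiv> child t (b 0) (\<lambda>y. alive k (seen_from (Suc 0) y b))"
  shows "1 \<le> b 0 (0, y)" "alive k (seen_from (Suc 0) y b)"
  using assms(1) childI[of "b 0" _ "\<lambda>y. alive k (seen_from (Suc 0) y b)" t]
  by (auto simp: y_def)

lemma leftmost_cong: "(\<And>n. n < k \<Longrightarrow> b n = b' n) \<Longrightarrow> leftmost t k b = leftmost t k b'"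
proof (induction k arbitrary: b b')
  case (Suc k)
  have "alive k (seen_from (Suc 0) y b) = alive k (seen_from (Suc 0) y b')" for y
    by (rule alive_cong) (simp add: seen_from_def Suc.prems)
  moreover have "leftmost t k (seen_from (Suc 0) y b) = leftmost t k (seen_from (Suc 0) y b')" for y
    by (rule Suc.IH) (simp add: seen_from_def Suc.prems)
  moreover have "b 0 = b' 0" by (rule Suc.prems) simp
  ultimately show ?case by simp
qed simp

text \<open>If the leftmost path of length \<open>i\<close> can be continued by \<open>j\<close>
  steps, each of its steps remains the first admissible one when depth \<open>i + j\<close> is
  demanded. Hence the leftmost path of length \<open>i + j\<close> begins with it.\<close>

lemma alive_env_at:
  assumes "alive i b" "alive j (env_at t i b)"
  shows "alive (i + j) b \<and> leftmost t (i + j) b = leftmost t i b + leftmost t j (env_at t i b)"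
  using assms
proof (induction i arbitrary: b)
  case (Suc i)
  define y where "y = child t (b 0) (\<lambda>y. alive i (seen_from (Suc 0) y b))"
  have y: "1 \<le> b 0 (0, y)" "alive i (seen_from (Suc 0) y b)"
    using alive_child[OF Suc.prems(1), of t] by (auto simp: y_def)
  have env: "env_at t (Suc i) b = env_at t i (seen_from (Suc 0) y b)"
    by (simp add: env_at_Suc y_def)
  have IH: "alive (i + j) (seen_from (Suc 0) y b)"
    "leftmost t (i + j) (seen_from (Suc 0) y b)
      = leftmost t i (seen_from (Suc 0) y b) + leftmost t j (env_at t i (seen_from (Suc 0) y b))"
    using Suc.IH[OF y(2)] Suc.prems(2) env by auto
  have "child t (b 0) (\<lambda>y. alive (i + j) (seen_from (Suc 0) y b)) = y"
    unfolding y_def using y IH(1) by (intro child_subset) (auto simp: y_def intro: alive_mono[of i "i + j"])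
  then show ?case
    using y(1) IH env by (auto simp: Let_def add.assoc y_def)
qed simp

lemma env_at_add:
  assumes "alive i b" "alive j (env_at t i b)"
  shows "env_at t (i + j) b = env_at t j (env_at t i b)"
  using alive_env_at[OF assms] by (simp add: env_at_def seen_from_seen_from)

lemma surv_env_at:
  assumes "alive i b" "surv (env_at t i b)"
  shows "surv b"
  unfolding surv_def
proof
  fix k
  show "alive k b"
    using alive_env_at[OF assms(1) surv_imp_alive[OF assms(2), of k]] alive_mono[of k "i + k" b] by simp
qed

text \<open>The value is unspecified if no positive depth qualifies; for surviving environments
  \<open>hereditary\<close> rules this out.\<close>

definition next_surv :: "ennreal \<Rightarrow> (nat \<Rightarrow> ('d::finite) lmatrix) \<Rightarrow> nat" where
  "next_surv t b = (LEAST k. 0 < k \<and> surv (env_at t k b))"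

definition new_start :: "ennreal \<Rightarrow> nat \<Rightarrow> (nat \<Rightarrow> ('d::finite) lmatrix) \<Rightarrow> bool" where
  "new_start t k b \<longleftrightarrow> alive k b \<and> (\<forall>j. 0 < j \<and> j < k \<longrightarrow> \<not> alive (k - j) (env_at t j b))"

text \<open>The vertex at depth \<open>k\<close> of the leftmost path of length \<open>k\<close> descends from the one at depth \<open>j\<close>
  as soon as the latter has any descendant at depth \<open>k\<close>. So, given that it survives, the event that
  no intermediate vertex survives is determined by the first \<open>k\<close> matrices.\<close>

lemma next_surv_eq_iff:
  assumes "0 < k"
  shows "(surv b \<and> surv (env_at t k b) \<and> next_surv t b = k) \<longleftrightarrow> new_start t k b \<and> surv (env_at t k b)"
proof (intro iffI conjI)
  assume "surv b \<and> surv (env_at t k b) \<and> next_surv t b = k"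
  then have b: "surv b" "surv (env_at t k b)" "k = next_surv t b" by auto
  have "\<not> alive (k - j) (env_at t j b)" if j: "0 < j" "j < k" for j
  proof
    assume a: "alive (k - j) (env_at t j b)"
    have "env_at t k b = env_at t (k - j) (env_at t j b)"
      using env_at_add[OF surv_imp_alive[OF b(1)] a] j by simp
    then have "surv (env_at t j b)"
      using surv_env_at[OF a, of t] b by simp
    then have "next_surv t b \<le> j"
      unfolding next_surv_def using j by (intro Least_le) auto
    with j b show False by simp
  qed
  then show "new_start t k b"
    using b by (auto simp: new_start_def surv_def)
  show "surv (env_at t k b)" by fact
next
  assume "new_start t k b \<and> surv (env_at t k b)"
  then have n: "new_start t k b" "surv (env_at t k b)" by auto
  then show "surv (env_at t k b)" "surv b"
    by (auto simp: new_start_def intro: surv_env_at)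
  show "next_surv t b = k"
    unfolding next_surv_def
  proof (rule Least_equality)
    show "0 < k \<and> surv (env_at t k b)" using n assms by simp
    fix j assume j: "0 < j \<and> surv (env_at t j b)"
    show "k \<le> j"
    proof (rule ccontr)
      assume "\<not> k \<le> j"
      then show False
        using n j surv_imp_alive[of "env_at t j b" "k - j"] by (auto simp: new_start_def)
    qed
  qed
qed

lemma new_start_cong:
  assumes "\<And>n. n < k \<Longrightarrow> b n = b' n"
  shows "new_start t k b = new_start t k b'"
proof -
  have "alive (k - j) (env_at t j b) = alive (k - j) (env_at t j b')" if "j < k" for j
  proof (rule alive_cong)
    fix n assume "n < k - j"
    moreover have "leftmost t j b = leftmost t j b'"
      using assms that by (intro leftmost_cong) auto
    ultimately show "env_at t j b n = env_at t j b' n"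
      using assms[of "n + j"] by (simp add: env_at_def seen_from_def)
  qed
  moreover have "alive k b = alive k b'"
    by (rule alive_cong) (rule assms)
  ultimately show ?thesis by (auto simp: new_start_def)
qed

section \<open>The leftmost infinite path\<close>

primrec spine :: "ennreal \<Rightarrow> nat \<Rightarrow> (nat \<Rightarrow> ('d::finite) lmatrix) \<Rightarrow> 'd lattice" where
  "spine t 0 b = 0"
| "spine t (Suc k) b =
    (let y = child t (b 0) (\<lambda>y. surv (seen_from (Suc 0) y b)) in y + spine t k (seen_from (Suc 0) y b))"

definition spine_env :: "ennreal \<Rightarrow> nat \<Rightarrow> (nat \<Rightarrow> ('d::finite) lmatrix) \<Rightarrow> nat \<Rightarrow> 'd lmatrix" where
  "spine_env t k b = seen_from k (spine t k b) b"

lemma spine_env_0 [simp]: "spine_env t 0 b = b"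
  by (simp add: spine_env_def)

lemma spine_add: "spine t (i + j) b = spine t i b + spine t j (spine_env t i b)"
  by (induction i arbitrary: b)
    (simp_all add: Let_def spine_env_def seen_from_seen_from add.assoc)

lemma spine_env_add: "spine_env t (i + j) b = spine_env t j (spine_env t i b)"
  by (simp add: spine_env_def[of t j] spine_env_def[of t "i + j"] spine_add)
     (simp add: spine_env_def seen_from_seen_from)

text \<open>When the endpoint survives, so do all earlier vertices of the path. The first child that
  reaches the required depth is then a survivor, and by \<open>child_subset\<close> the first one
  among the survivors.\<close>

lemma spine_eq_leftmost:
  assumes "alive k b" "surv (env_at t k b)"
  shows "spine t k b = leftmost t k b"
  using assms
proof (induction k arbitrary: b)
  case (Suc k)
  define y where "y = child t (b 0) (\<lambda>y. alive k (seen_from (Suc 0) y b))"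
  have y: "1 \<le> b 0 (0, y)" "alive k (seen_from (Suc 0) y b)"
    using alive_child[OF Suc.prems(1), of t] by (auto simp: y_def)
  have s: "surv (env_at t k (seen_from (Suc 0) y b))"
    using Suc.prems(2) by (simp add: env_at_Suc y_def)
  then have "surv (seen_from (Suc 0) y b)"
    using y(2) by (rule surv_env_at[rotated])
  then have "child t (b 0) (\<lambda>y. surv (seen_from (Suc 0) y b)) = y"
    unfolding y_def using y by (intro child_subset) (auto simp: y_def surv_def)
  then show ?case
    using Suc.IH[OF y(2) s] by (simp add: Let_def y_def)
qed simp

lemma spine_env_eq_env_at:
  "alive k b \<Longrightarrow> surv (env_at t k b) \<Longrightarrow> spine_env t k b = env_at t k b"
  by (simp add: spine_env_def env_at_def spine_eq_leftmost)

text \<open>Quantifying over all space-time points makes the property pass to every environment met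
  along a path, while countability keeps it an almost sure event.\<close>

definition hereditary :: "ennreal \<Rightarrow> (nat \<Rightarrow> ('d::finite) lmatrix) \<Rightarrow> bool" where
  "hereditary t b \<longleftrightarrow>
    (\<forall>k x. surv (seen_from k x b) \<longrightarrow> (\<exists>j>0. surv (env_at t j (seen_from k x b))))"

lemma hereditary_seen_from: "hereditary t b \<Longrightarrow> hereditary t (seen_from k x b)"
  by (simp add: hereditary_def seen_from_seen_from)

text \<open>The first vertex of a leftmost path with surviving endpoint is a surviving child. This
  stands in for Koenig's lemma, which would require finitely many children.\<close>

lemma hereditary_spine:
  assumes "hereditary t b" "surv b"
  shows "1 \<le> b 0 (0, spine t 1 b)" "surv (spine_env t 1 b)"
proof -
  obtain j where j: "0 < j" "surv (env_at t j b)"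
    using assms unfolding hereditary_def by (metis seen_from_0)
  then obtain i where i: "j = Suc i" by (cases j) auto
  define y where "y = child t (b 0) (\<lambda>y. alive i (seen_from (Suc 0) y b))"
  have y: "1 \<le> b 0 (0, y)" "alive i (seen_from (Suc 0) y b)"
    using alive_child[of i b t] surv_imp_alive[OF assms(2), of "Suc i"] by (auto simp: y_def)
  have "surv (seen_from (Suc 0) y b)"
    using j y(2) by (auto simp: i env_at_Suc y_def intro: surv_env_at)
  from childI[of "b 0" y "\<lambda>y. surv (seen_from (Suc 0) y b)" t, OF y(1) this]
  show "1 \<le> b 0 (0, spine t 1 b)" "surv (spine_env t 1 b)"
    by (auto simp: spine_env_def Let_def)
qed

lemma hereditary_path_env:
  assumes "hereditary t b" "surv b"
  shows "surv (spine_env t k b)"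
proof (induction k)
  case (Suc k)
  have "hereditary t (spine_env t k b)"
    using assms(1) by (simp add: spine_env_def hereditary_seen_from)
  then show ?case
    using hereditary_spine(2)[OF _ Suc] spine_env_add[of t k 1 b] by simp
qed (use assms in simp)

lemma spine_step:
  "b n (spine t n b, spine t (Suc n) b) = spine_env t n b 0 (0, spine t 1 (spine_env t n b))"
  using spine_add[of t n 1 b] by (simp add: spine_env_def seen_from_apply ac_simps)

lemma spine_open:
  assumes "hereditary t b" "surv b"
  shows "1 \<le> b n (spine t n b, spine t (Suc n) b)"
  unfolding spine_step
  using assms hereditary_path_env[OF assms, of n]
  by (intro hereditary_spine) (simp_all add: spine_env_def hereditary_seen_from)

definition renew :: "ennreal \<Rightarrow> (nat \<Rightarrow> ('d::finite) lmatrix) \<Rightarrow> nat \<Rightarrow> 'd lmatrix" where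
  "renew t b = env_at t (next_surv t b) b"

lemma hereditary_renew:
  assumes "hereditary t b" "surv b"
  shows "0 < next_surv t b" "surv (renew t b)" "renew t b = spine_env t (next_surv t b) b"
    "hereditary t (renew t b)"
proof -
  have "\<exists>j>0. surv (env_at t j b)"
    using assms unfolding hereditary_def by (metis seen_from_0)
  then have *: "0 < next_surv t b \<and> surv (env_at t (next_surv t b) b)"
    unfolding next_surv_def by (rule LeastI_ex)
  then show "0 < next_surv t b" "surv (renew t b)"
    by (auto simp: renew_def)
  show "renew t b = spine_env t (next_surv t b) b"
    using * assms spine_env_eq_env_at[of "next_surv t b" b t] by (simp add: renew_def surv_imp_alive)
  show "hereditary t (renew t b)"
    using assms(1) by (simp add: renew_def env_at_def hereditary_seen_from)
qed

section \<open>Counting heavy steps\<close>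

definition heavy :: "ennreal \<Rightarrow> (nat \<Rightarrow> ('d::finite) lmatrix) \<Rightarrow> bool" where
  "heavy t b \<longleftrightarrow> (\<exists>y. t \<le> b 0 (0, y))"

definition heavy_steps :: "ennreal \<Rightarrow> nat \<Rightarrow> (nat \<Rightarrow> ('d::finite) lmatrix) \<Rightarrow> nat" where
  "heavy_steps t n b = card {i. i < n \<and> t \<le> b i (spine t i b, spine t (Suc i) b)}"

lemma heavy_steps_0 [simp]: "heavy_steps t 0 b = 0"
  by (simp add: heavy_steps_def)

lemma heavy_steps_mono: "m \<le> n \<Longrightarrow> heavy_steps t m b \<le> heavy_steps t n b"
  unfolding heavy_steps_def by (intro card_mono) auto

lemma heavy_steps_Suc:
  "heavy_steps t (Suc n) b
    = heavy_steps t n b + (if t \<le> b n (spine t n b, spine t (Suc n) b) then 1 else 0)"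
proof -
  have "{i. i < Suc n \<and> t \<le> b i (spine t i b, spine t (Suc i) b)}
     = {i. i < n \<and> t \<le> b i (spine t i b, spine t (Suc i) b)} \<union>
       (if t \<le> b n (spine t n b, spine t (Suc n) b) then {n} else {})"
    by (auto simp: less_Suc_eq)
  then show ?thesis by (simp add: heavy_steps_def)
qed

lemma heavy_steps_add: "heavy_steps t (i + j) b = heavy_steps t i b + heavy_steps t j (spine_env t i b)"
proof (induction j)
  case (Suc j)
  have "b (i + j) (spine t (i + j) b, spine t (Suc (i + j)) b)
     = spine_env t i b j (spine t j (spine_env t i b), spine t (Suc j) (spine_env t i b))"
    unfolding spine_step by (simp add: spine_env_add)
  then show ?case
    using Suc by (simp add: heavy_steps_Suc)
qed simp

text \<open>A path of length one has no survival condition to meet, so in a heavy environment it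
  goes to position 0 of \<open>site\<close>. A gap of 1 means that this very site survives, so the
  infinite path makes the same heavy step.\<close>

lemma heavy_steps_next_surv:
  assumes "1 \<le> t" "hereditary t b" "surv b"
  shows "of_bool (next_surv t b = 1 \<and> heavy t b) \<le> heavy_steps t (next_surv t b) b"
proof (cases "next_surv t b = 1 \<and> heavy t b")
  case True
  then obtain y where y: "t \<le> b 0 (0, y)" by (auto simp: heavy_def)
  have c: "child t (b 0) (\<lambda>y. alive 0 (seen_from (Suc 0) y b)) = site t (b 0) 0"
    using assms(1) y by (intro child_heavy[of t "b 0" y]) auto
  have "surv (env_at t 1 b)"
    using True hereditary_renew(2)[OF assms(2,3)] by (simp add: renew_def)
  then have "spine t 1 b = leftmost t 1 b"
    using assms(3) by (intro spine_eq_leftmost) (auto simp: surv_def)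
  also have "\<dots> = site t (b 0) 0"
    using c by (simp add: Let_def)
  finally have "t \<le> b 0 (0, spine t (Suc 0) b)"
    using site_0[of t "b 0" y] y by simp
  then have "heavy_steps t (Suc 0) b = 1"
    by (simp add: heavy_steps_Suc del: spine.simps(2))
  then show ?thesis using True by simp
qed auto

text \<open>Passage from counting by renewals to counting by time. The time \<open>n\<close> is
  placed between consecutive renewal times, \<open>u i \<le> n < u (Suc i)\<close>: the later one
  bounds elapsed time from above, the earlier one bounds the heavy steps from below. The loss of 1
  is the heavy renewal that may start the interval containing \<open>n\<close>.\<close>

lemma heavy_steps_lower_bound:
  assumes "1 \<le> t" "hereditary t b" "surv b" "0 \<le> \<alpha>"
    and C: "\<And>n. (\<Sum>i<n. \<alpha> * real (next_surv t ((renew t ^^ i) b))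
      - of_bool (next_surv t ((renew t ^^ i) b) = 1 \<and> heavy t ((renew t ^^ i) b))) \<le> C"
  shows "\<alpha> * real n - C - 1 \<le> real (heavy_steps t n b)"
proof -
  define s where "s i = next_surv t ((renew t ^^ i) b)" for i
  define h :: "nat \<Rightarrow> real" where "h i = of_bool (s i = 1 \<and> heavy t ((renew t ^^ i) b))" for i
  define u where "u j = (\<Sum>i<j. s i)" for j
  have iter: "hereditary t ((renew t ^^ i) b) \<and> surv ((renew t ^^ i) b)" for i
    using assms(2,3) by (induction i) (simp_all add: hereditary_renew(2,4))
  have s_pos: "0 < s i" for i
    unfolding s_def using iter hereditary_renew(1) by blast
  have env: "spine_env t (u j) b = (renew t ^^ j) b" for j
  proof (induction j)
    case (Suc j)
    then show ?case
      using hereditary_renew(3)[of t "(renew t ^^ j) b"] iter[of j]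
      by (simp add: u_def spine_env_add s_def)
  qed (simp add: u_def)
  have steps: "(\<Sum>i<j. h i) \<le> real (heavy_steps t (u j) b)" for j
  proof (induction j)
    case (Suc j)
    have "h j \<le> real (heavy_steps t (s j) ((renew t ^^ j) b))"
      using heavy_steps_next_surv[OF assms(1), of "(renew t ^^ j) b"] iter[of j]
      unfolding h_def s_def of_bool_def by (auto split: if_splits)
    then show ?case
      using Suc by (simp add: u_def heavy_steps_add env[unfolded u_def])
  qed (simp add: u_def)
  have "n < u (Suc n)"
  proof -
    have "(\<Sum>i<Suc n. 1) \<le> u (Suc n)"
      unfolding u_def using s_pos by (intro sum_mono) (simp add: Suc_leI)
    then show ?thesis by simp
  qed
  then have "\<exists>j. n < u j" by blast
  define j where "j = (LEAST j. n < u j)"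
  have j: "n < u j"
    unfolding j_def by (rule LeastI_ex) fact
  then obtain i where i: "j = Suc i" by (cases j) (auto simp: u_def)
  have "u i \<le> n"
    using not_less_Least[of i "\<lambda>j. n < u j"] i by (auto simp: j_def)
  have "\<alpha> * real (u j) - C \<le> (\<Sum>k<j. h k)"
    using C[of j] by (simp add: u_def s_def h_def sum_subtractf sum_distrib_left)
  also have "\<dots> \<le> (\<Sum>k<i. h k) + 1"
    by (simp add: i h_def)
  also have "\<dots> \<le> real (heavy_steps t (u i) b) + 1"
    using steps by simp
  also have "\<dots> \<le> real (heavy_steps t n b) + 1"
    using heavy_steps_mono[OF \<open>u i \<le> n\<close>, of t b] by simp
  finally have "\<alpha> * real (u j) - C \<le> real (heavy_steps t n b) + 1" .
  moreover have "\<alpha> * real n \<le> \<alpha> * real (u j)"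
    using j assms(4) by (intro mult_left_mono) auto
  ultimately show ?thesis by simp
qed

lemma heavy_steps_weight:
  assumes "hereditary t b" "surv b"
  shows "t ^ heavy_steps t n b \<le> (\<Prod>i<n. b i (spine t i b, spine t (Suc i) b))"
proof (induction n)
  case (Suc n)
  show ?case
  proof (cases "t \<le> b n (spine t n b, spine t (Suc n) b)")
    case True
    then show ?thesis
      using mult_mono[OF Suc True] by (simp add: heavy_steps_Suc mult.commute del: spine.simps(2))
  next
    case False
    then show ?thesis
      using mult_mono[OF Suc spine_open[OF assms, of n]] by (simp add: heavy_steps_Suc del: spine.simps(2))
  qed
qed simp

section \<open>A maximal ergodic argument\<close>

lemma (in prob_space) indep_varI:
  assumes [measurable]: "X \<in> measurable M S" "Y \<in> measurable M T"
  assumes "\<And>A B. A \<in> sets S \<Longrightarrow> B \<in> sets T \<Longrightarrow>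
    prob {x \<in> space M. X x \<in> A \<and> Y x \<in> B} = prob {x \<in> space M. X x \<in> A} * prob {x \<in> space M. Y x \<in> B}"
  shows "indep_var S X T Y"
  unfolding indep_var_eq
proof (intro conjI indep_set_sigma_sets)
  show "Int_stable {X -` A \<inter> space M | A. A \<in> sets S}"
  proof (safe intro!: Int_stableI)
    fix A B assume "A \<in> sets S" "B \<in> sets S"
    then show "\<exists>C. (X -` A \<inter> space M) \<inter> (X -` B \<inter> space M) = X -` C \<inter> space M \<and> C \<in> sets S"
      by (intro exI[of _ "A \<inter> B"]) auto
  qed
  show "Int_stable {Y -` A \<inter> space M | A. A \<in> sets T}"
  proof (safe intro!: Int_stableI)
    fix A B assume "A \<in> sets T" "B \<in> sets T"
    then show "\<exists>C. (Y -` A \<inter> space M) \<inter> (Y -` B \<inter> space M) = Y -` C \<inter> space M \<and> C \<in> sets T"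
      by (intro exI[of _ "A \<inter> B"]) auto
  qed
  show "indep_set {X -` A \<inter> space M | A. A \<in> sets S} {Y -` A \<inter> space M | A. A \<in> sets T}"
  proof (safe intro!: indep_setI)
    fix A B assume A: "A \<in> sets S" and B: "B \<in> sets T"
    have "(X -` A \<inter> space M) \<inter> (Y -` B \<inter> space M) = {x \<in> space M. X x \<in> A \<and> Y x \<in> B}"
      "X -` A \<inter> space M = {x \<in> space M. X x \<in> A}" "Y -` B \<inter> space M = {x \<in> space M. Y x \<in> B}"
      by auto
    then show "prob (X -` A \<inter> space M \<inter> (Y -` B \<inter> space M))
      = prob (X -` A \<inter> space M) * prob (Y -` B \<inter> space M)"
      using assms(3)[OF A B] by simp
  qed auto
qed (use assms in auto)

text \<open>The running maximum satisfies \<open>m\<^sub>n\<^sub>+\<^sub>1 = max 0 (f + m\<^sub>n \<circ> T)\<close>, so integrating over the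
  invariant event \<open>I\<close> that it is unbounded shows that \<open>f\<close> has nonnegative integral over \<open>I\<close>. By
  independence this integral is the mean of \<open>f\<close> times the probability of \<open>I\<close>.\<close>

lemma (in prob_space) AE_partial_sums_bounded_above:
  fixes f :: "'a \<Rightarrow> real"
  assumes T [measurable]: "T \<in> measurable M M" and inv: "distr M M T = M"
    and f: "integrable M f" and neg: "(\<integral>x. f x \<partial>M) < 0"
    and ind: "\<And>A. A \<in> sets M \<Longrightarrow> indep_var borel f borel (\<lambda>x. indicat_real A (T x))"
  shows "AE x in M. \<exists>C. \<forall>n. (\<Sum>i<n. f ((T ^^ i) x)) \<le> C"
proof -
  note [measurable] = borel_measurable_integrable[OF f]
  define m where "m n = ((\<lambda>g x. max 0 (f x + g (T x))) ^^ n) (\<lambda>_. 0)" for n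
  have m_0: "m 0 x = 0" and m_Suc: "m (Suc n) x = max 0 (f x + m n (T x))" for n x
    by (simp_all add: m_def)
  have m_meas [measurable]: "m n \<in> borel_measurable M" for n
  proof (induction n)
    case (Suc n)
    have [measurable]: "m n \<in> borel_measurable M" by fact
    have "(\<lambda>x. max 0 (f x + m n (T x))) \<in> borel_measurable M" by measurable
    then show ?case by (simp add: m_Suc[abs_def])
  qed (simp add: m_0[abs_def])
  have m_nonneg: "0 \<le> m n x" for n x
    by (cases n) (simp_all add: m_0 m_Suc)
  have m_mono: "m n x \<le> m (Suc n) x" for n x
  proof (induction n arbitrary: x)
    case (Suc n)
    show ?case using Suc[of "T x"] by (simp add: m_Suc max.coboundedI2)
  qed (simp add: m_0 m_Suc)
  have m_int: "integrable M (m n)" for n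
  proof (induction n)
    case (Suc n)
    have "integrable M (\<lambda>x. m n (T x))"
      using integrable_distr_eq[of T M M "m n"] Suc inv by simp
    then have "integrable M (\<lambda>x. f x + m n (T x))"
      using f by simp
    then have "integrable M (\<lambda>x. max 0 (f x + m n (T x)))"
      by (rule Bochner_Integration.integrable_bound) auto
    then show ?case by (simp add: m_Suc[abs_def])
  qed (simp add: m_0[abs_def])
  have sum_le: "(\<Sum>i<n. f ((T ^^ i) x)) \<le> m n x" for n x
  proof (induction n arbitrary: x)
    case (Suc n)
    have "(\<Sum>i<Suc n. f ((T ^^ i) x)) = f x + (\<Sum>i<n. f ((T ^^ i) (T x)))"
      by (subst sum.lessThan_Suc_shift) (simp add: funpow_swap1)
    with Suc[of "T x"] show ?case by (simp add: m_Suc)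
  qed (simp add: m_0)
  define I where "I = {x \<in> space M. \<forall>C::nat. \<exists>n. real C < m n x}"
  have I [measurable]: "I \<in> sets M"
    unfolding I_def by measurable
  \<comment> \<open>Up to truncation at 0, \<open>m (Suc n) x\<close> and \<open>m n (T x)\<close>
    differ by \<open>f x\<close>, which does not depend on \<open>n\<close>; so they are unbounded
    together.\<close>
  have I_T: "T x \<in> I \<longleftrightarrow> x \<in> I" if x: "x \<in> space M" for x
  proof -
    have "T x \<in> space M" using x T by (auto simp: measurable_def)
    moreover have "(\<forall>C::nat. \<exists>n. real C < m n (T x)) \<longleftrightarrow> (\<forall>C::nat. \<exists>n. real C < m n x)"
    proof (intro iffI allI)
      fix C :: nat assume *: "\<forall>C::nat. \<exists>n. real C < m n (T x)"
      obtain D :: nat where D: "real C - f x \<le> real D" using real_arch_simple by blast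
      obtain n where "real D < m n (T x)" using * by blast
      with D have "real C < m (Suc n) x" by (simp add: m_Suc)
      then show "\<exists>n. real C < m n x" ..
    next
      fix C :: nat assume *: "\<forall>C::nat. \<exists>n. real C < m n x"
      obtain D :: nat where D: "real C + \<bar>f x\<bar> \<le> real D" using real_arch_simple by blast
      obtain n where n: "real D < m n x" using * by blast
      then obtain k where k: "n = Suc k" using m_0 by (cases n) auto
      have "real C < m k (T x)" using n D by (auto simp: k m_Suc max_def split: if_splits)
      then show "\<exists>n. real C < m n (T x)" ..
    qed
    ultimately show ?thesis using x by (simp add: I_def)
  qed
  let ?I = "indicat_real I"
  \<comment> \<open>By invariance of the measure, \<open>m n\<close> composed with \<open>T\<close>
    has the same integral over \<open>I\<close> as \<open>m n\<close>, hence at most that of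
    \<open>m (Suc n)\<close>. The difference of the two integrands is \<open>f\<close> truncated
    from below at \<open>- m n (T x)\<close>.\<close>
  have step: "0 \<le> (\<integral>x. ?I x * max (- m n (T x)) (f x) \<partial>M)" for n
  proof -
    have int1: "integrable M (\<lambda>x. ?I x * m n x)" for n
      using integrable_real_mult_indicator[OF I m_int[of n]] by (simp add: mult.commute)
    have int2: "integrable M (\<lambda>x. ?I (T x) * m n (T x))"
      using integrable_distr_eq[of T M M "\<lambda>x. ?I x * m n x"] int1[of n] inv by simp
    have "(\<integral>x. ?I (T x) * m n (T x) \<partial>M) = (\<integral>x. ?I x * m n x \<partial>M)"
      using integral_distr[of T M M "\<lambda>x. ?I x * m n x"] inv by simp
    also have "\<dots> \<le> (\<integral>x. ?I x * m (Suc n) x \<partial>M)"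
      using int1 by (intro integral_mono mult_left_mono m_mono) auto
    finally have "0 \<le> (\<integral>x. ?I x * m (Suc n) x - ?I (T x) * m n (T x) \<partial>M)"
      using int1 int2 by simp
    also have "\<dots> = (\<integral>x. ?I x * max (- m n (T x)) (f x) \<partial>M)"
    proof (rule Bochner_Integration.integral_cong[OF refl])
      fix x assume "x \<in> space M"
      then have "?I (T x) = ?I x" using I_T by (simp add: indicator_def)
      moreover have "m (Suc n) x - m n (T x) = max (- m n (T x)) (f x)"
        by (simp add: m_Suc max_def)
      ultimately show "?I x * m (Suc n) x - ?I (T x) * m n (T x) = ?I x * max (- m n (T x)) (f x)"
        by (simp add: right_diff_distrib[symmetric])
    qed
    finally show ?thesis .
  qed
  \<comment> \<open>On \<open>I\<close> the truncation level tends to minus infinity, so the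
    truncation eventually disappears; since \<open>m n\<close> is nonnegative, the truncated
    function is dominated by the absolute value of \<open>f\<close>.\<close>
  have "(\<lambda>n. \<integral>x. ?I x * max (- m n (T x)) (f x) \<partial>M) \<longlonglongrightarrow> (\<integral>x. ?I x * f x \<partial>M)"
  proof (rule integral_dominated_convergence[where w="\<lambda>x. \<bar>f x\<bar>"])
    show "AE x in M. (\<lambda>n. ?I x * max (- m n (T x)) (f x)) \<longlonglongrightarrow> ?I x * f x"
    proof (rule AE_I2)
      fix x assume x: "x \<in> space M"
      show "(\<lambda>n. ?I x * max (- m n (T x)) (f x)) \<longlonglongrightarrow> ?I x * f x"
      proof (cases "x \<in> I")
        case True
        then have "T x \<in> I" using I_T x by simp
        obtain D :: nat where D: "- f x \<le> real D" using real_arch_simple by blast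
        obtain n where n: "real D < m n (T x)" using \<open>T x \<in> I\<close> by (auto simp: I_def)
        have "?I x * max (- m k (T x)) (f x) = ?I x * f x" if "n \<le> k" for k
        proof -
          have "m n (T x) \<le> m k (T x)"
            using that m_mono by (rule lift_Suc_mono_le[rotated])
          then show ?thesis using n D by simp
        qed
        then have "eventually (\<lambda>k. ?I x * max (- m k (T x)) (f x) = ?I x * f x) sequentially"
          by (auto simp: eventually_sequentially)
        then show ?thesis by (rule tendsto_eventually)
      qed simp
    qed
    show "AE x in M. norm (?I x * max (- m n (T x)) (f x)) \<le> \<bar>f x\<bar>" for n
    proof (rule AE_I2)
      fix x
      show "norm (?I x * max (- m n (T x)) (f x)) \<le> \<bar>f x\<bar>"
        using m_nonneg[of n "T x"] by (auto simp: indicator_def max_def)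
    qed
  qed (use f in auto)
  then have "0 \<le> (\<integral>x. ?I x * f x \<partial>M)"
    using step by (intro LIMSEQ_le_const) auto
  \<comment> \<open>Invariance of \<open>I\<close> allows its indicator to be evaluated at
    \<open>T x\<close>, and in that form it is independent of \<open>f\<close>.\<close>
  also have "(\<integral>x. ?I x * f x \<partial>M) = (\<integral>x. f x * ?I (T x) \<partial>M)"
    using I_T by (intro Bochner_Integration.integral_cong) (auto simp: indicator_def)
  also have "\<dots> = (\<integral>x. f x \<partial>M) * (\<integral>x. ?I (T x) \<partial>M)"
  proof (rule indep_var_lebesgue_integral[OF _ f])
    show "indep_var borel f borel (\<lambda>x. ?I (T x))" by (rule ind[OF I])
    show "integrable M (\<lambda>x. ?I (T x))"
      by (intro integrable_const_bound[of _ 1]) auto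
  qed
  also have "(\<integral>x. ?I (T x) \<partial>M) = prob I"
    using integral_distr[of T M M ?I] inv by simp
  finally have "prob I = 0"
    using neg measure_nonneg[of M I] by (auto simp: zero_le_mult_iff)
  then have "AE x in M. x \<notin> I"
    using I by (intro AE_not_in) (auto simp: null_sets_def emeasure_eq_measure)
  with AE_space show ?thesis
  proof eventually_elim
    case (elim x)
    then obtain C :: nat where C: "\<And>n. m n x \<le> real C"
      by (auto simp: I_def not_less)
    show ?case
      by (intro exI[of _ "real C"] allI order_trans[OF sum_le C])
  qed
qed

section \<open>Independent environments\<close>

definition env_space :: "(nat \<Rightarrow> ('d::finite) lmatrix) measure" where
  "env_space = (\<Pi>\<^sub>M n\<in>UNIV. matrix_space)"

lemma space_matrix_space [simp]: "space matrix_space = UNIV"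
  by (simp add: matrix_space_def space_PiM)

lemma space_env_space [simp]: "space env_space = UNIV"
  by (simp add: env_space_def space_PiM)

lemma matrix_entry_measurable [measurable (raw)]:
  "f \<in> measurable N matrix_space \<Longrightarrow> (\<lambda>x. f x p) \<in> borel_measurable N"
  unfolding matrix_space_def by (rule measurable_compose[OF _ measurable_component_singleton]) auto

lemma matrix_measurableI:
  "(\<And>p. (\<lambda>x. f x p) \<in> borel_measurable N) \<Longrightarrow> f \<in> measurable N matrix_space"
  unfolding matrix_space_def by (rule measurable_PiM_single') auto

lemma env_component_measurable [measurable (raw)]:
  "f \<in> measurable N env_space \<Longrightarrow> (\<lambda>x. f x n) \<in> measurable N matrix_space"
  unfolding env_space_def by (rule measurable_compose[OF _ measurable_component_singleton]) auto

lemma env_measurableI: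
  "(\<And>n. (\<lambda>x. f x n) \<in> measurable N matrix_space) \<Longrightarrow> f \<in> measurable N env_space"
  unfolding env_space_def by (rule measurable_PiM_single') auto

lemma translate_measurable [measurable]: "translate z \<in> measurable matrix_space matrix_space"
  by (rule matrix_measurableI) (simp add: translate_def split: prod.split)

lemma seen_from_measurable [measurable]: "seen_from k x \<in> measurable env_space env_space"
  unfolding seen_from_def by (intro env_measurableI measurable_compose[OF _ translate_measurable]) measurable

lemma alive_measurable [measurable]: "Measurable.pred env_space (alive k)"
proof (induction k)
  case (Suc k)
  note [measurable] = measurable_compose[OF seen_from_measurable Suc.IH]
  show ?case unfolding alive.simps by measurable
qed simp

lemma surv_measurable [measurable]: "Measurable.pred env_space surv"
  unfolding surv_def by measurable

lemma site_measurable [measurable (raw)]: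
  assumes [measurable]: "a \<in> measurable N matrix_space"
  shows "(\<lambda>x. site t (a x) r) \<in> measurable N (count_space UNIV)"
  unfolding site_def by (cases r) (simp_all, measurable)

lemma child_measurable:
  assumes [measurable]: "a \<in> measurable N matrix_space" "\<And>y. Measurable.pred N (\<lambda>x. U y x)"
  shows "(\<lambda>x. child t (a x) (\<lambda>y. U y x)) \<in> measurable N (count_space UNIV)"
proof -
  have [measurable]: "Measurable.pred N (\<lambda>x. 1 \<le> a x (0, site t (a x) r) \<and> U (site t (a x) r) x)" for r
    by (rule measurable_compose_countable[where f="\<lambda>y x. 1 \<le> a x (0, y) \<and> U y x"]) measurable
  have "(\<lambda>x. site t (a x) (LEAST r. 1 \<le> a x (0, site t (a x) r) \<and> U (site t (a x) r) x))
    \<in> measurable N (count_space UNIV)"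
    by (rule measurable_compose_countable) measurable
  then show ?thesis by (simp add: child_def)
qed

lemma leftmost_measurable [measurable]:
  "leftmost t k \<in> measurable (env_space :: (nat \<Rightarrow> ('d::finite) lmatrix) measure) (count_space UNIV)"
proof (induction k)
  case (Suc k)
  note [measurable] = measurable_compose[OF seen_from_measurable Suc.IH]
  have [measurable]: "Measurable.pred env_space (\<lambda>b. alive k (seen_from (Suc 0) y b))" for y :: "'d lattice"
    by (rule measurable_compose[OF seen_from_measurable]) measurable
  have "(\<lambda>b. (\<lambda>(y :: 'd lattice) b. y + leftmost t k (seen_from (Suc 0) y b))
      (child t (b 0) (\<lambda>y. alive k (seen_from (Suc 0) y b))) b) \<in> measurable env_space (count_space UNIV)"
    by (rule measurable_compose_countable[OF _ child_measurable]) measurable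
  then show ?case by (simp add: Let_def)
qed simp

lemma env_at_measurable [measurable]: "env_at t k \<in> measurable env_space env_space"
  unfolding env_at_def by (rule measurable_compose_countable[OF seen_from_measurable]) measurable

lemma spine_measurable [measurable]:
  "spine t k \<in> measurable (env_space :: (nat \<Rightarrow> ('d::finite) lmatrix) measure) (count_space UNIV)"
proof (induction k)
  case (Suc k)
  note [measurable] = measurable_compose[OF seen_from_measurable Suc.IH]
  have [measurable]: "Measurable.pred env_space (\<lambda>b. surv (seen_from (Suc 0) y b))" for y :: "'d lattice"
    by (rule measurable_compose[OF seen_from_measurable]) measurable
  have "(\<lambda>b. (\<lambda>(y :: 'd lattice) b. y + spine t k (seen_from (Suc 0) y b))
      (child t (b 0) (\<lambda>y. surv (seen_from (Suc 0) y b))) b) \<in> measurable env_space (count_space UNIV)"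
    by (rule measurable_compose_countable[OF _ child_measurable]) measurable
  then show ?case by (simp add: Let_def)
qed simp

lemma next_surv_measurable [measurable]: "next_surv t \<in> measurable env_space (count_space UNIV)"
proof -
  have [measurable]: "Measurable.pred env_space (\<lambda>b. surv (env_at t k b))" for k
    by (rule measurable_compose[OF env_at_measurable]) measurable
  show ?thesis unfolding next_surv_def by measurable
qed

lemma renew_measurable [measurable]: "renew t \<in> measurable env_space env_space"
  unfolding renew_def by (rule measurable_compose_countable[OF env_at_measurable]) measurable

lemma heavy_measurable [measurable]: "Measurable.pred env_space (heavy t)"
  unfolding heavy_def by measurable

lemma new_start_measurable [measurable]: "Measurable.pred env_space (new_start t k)"
proof -
  have [measurable]: "Measurable.pred env_space (\<lambda>b. alive i (env_at t j b))" for i j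
    by (rule measurable_compose[OF env_at_measurable]) measurable
  show ?thesis unfolding new_start_def by measurable
qed

locale iid_matrices = sequence_space M for M :: "('d::finite) lmatrix measure" +
  assumes sets_M: "sets M = sets matrix_space"
    and transl: "distr M matrix_space (translate z) = M"
begin

lemma sets_S: "sets S = sets env_space"
  unfolding env_space_def by (intro sets_PiM_cong) (simp_all add: sets_M)

declare sets_S [measurable_cong] sets_M [measurable_cong]

lemma space_M [simp]: "space M = UNIV"
  using sets_eq_imp_space_eq[OF sets_M] by simp

lemma space_S [simp]: "space S = UNIV"
  using sets_eq_imp_space_eq[OF sets_S] by simp

lemma measurable_S: "measurable S N = measurable env_space N"
  by (rule measurable_cong_sets) (simp_all add: sets_S)

lemma distr_translate: "distr S S (seen_from 0 x) = S"
proof (rule PiM_eq)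
  have meas [measurable]: "seen_from 0 x \<in> measurable S S" by measurable
  show "sets (distr S S (seen_from 0 x)) = sets S" by simp
  fix J F assume J: "finite J" "J \<subseteq> (UNIV :: nat set)" "\<And>j. j \<in> J \<Longrightarrow> F j \<in> sets M"
  have tr [measurable]: "translate x \<in> measurable M M" by measurable
  have vim: "translate x -` F j \<in> sets M" if "j \<in> J" for j
    using measurable_sets[OF tr J(3)[OF that]] by simp
  have eq: "seen_from 0 x -` prod_emb UNIV (\<lambda>_. M) J (\<Pi>\<^sub>E j\<in>J. F j) \<inter> space S
    = prod_emb UNIV (\<lambda>_. M) J (\<Pi>\<^sub>E j\<in>J. translate x -` F j)"
    by (auto simp: prod_emb_def PiE_iff seen_from_def)
  have "emeasure (distr S S (seen_from 0 x)) (prod_emb UNIV (\<lambda>_. M) J (\<Pi>\<^sub>E j\<in>J. F j))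
    = emeasure S (prod_emb UNIV (\<lambda>_. M) J (\<Pi>\<^sub>E j\<in>J. translate x -` F j))"
    using J by (subst emeasure_distr) (simp_all add: eq[simplified] sets_PiM_I)
  also have "\<dots> = (\<Prod>j\<in>J. emeasure M (translate x -` F j))"
    using J vim by (intro emeasure_PiM_emb) auto
  also have "\<dots> = (\<Prod>j\<in>J. emeasure M (F j))"
  proof (rule prod.cong[OF refl])
    fix j assume j: "j \<in> J"
    have "emeasure M (F j) = emeasure (distr M matrix_space (translate x)) (F j)"
      by (simp add: transl)
    also have "\<dots> = emeasure M (translate x -` F j)"
      using J(3)[OF j] by (subst emeasure_distr) (simp_all add: sets_M measurable_cong_sets[OF sets_M refl])
    finally show "emeasure M (translate x -` F j) = emeasure M (F j)" by simp
  qed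
  finally show "emeasure (distr S S (seen_from 0 x)) (prod_emb UNIV (\<lambda>_. M) J (\<Pi>\<^sub>E j\<in>J. F j))
    = (\<Prod>j\<in>J. emeasure M (F j))" .
qed

text \<open>Fubini after cutting the sequence at time \<open>k\<close>. With the first
  \<open>k\<close> matrices fixed, \<open>E\<close> and the site \<open>loc\<close> are constants,
  and an independent future seen from a constant site keeps its law by
  \<open>distr_translate\<close>.\<close>

lemma markov:
  assumes [measurable]: "Measurable.pred env_space E" "Measurable.pred env_space A"
    "loc \<in> measurable env_space (count_space UNIV)"
  assumes E: "\<And>b b'. (\<And>n. n < k \<Longrightarrow> b n = b' n) \<Longrightarrow> E b = E b'"
    and loc: "\<And>b b'. (\<And>n. n < k \<Longrightarrow> b n = b' n) \<Longrightarrow> loc b = loc b'"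
  shows "emeasure S {b. E b \<and> A (seen_from k (loc b) b)} = emeasure S {b. E b} * emeasure S {b. A b}"
proof -
  let ?X = "{b. E b \<and> A (seen_from k (loc b) b)}"
  have [measurable]: "(\<lambda>b. seen_from k (loc b) b) \<in> measurable env_space env_space"
    by (rule measurable_compose_countable[OF seen_from_measurable]) measurable
  have "Measurable.pred S (\<lambda>b. E b \<and> A (seen_from k (loc b) b))"
    by measurable
  then have X: "?X \<in> sets S"
    by (simp add: pred_def)
  let ?c = "\<lambda>(\<omega>, \<omega>'). comb_seq k \<omega> \<omega>'"
  have c: "?c \<in> measurable (S \<Otimes>\<^sub>M S) S"
    by measurable
  have "emeasure S ?X = emeasure (distr (S \<Otimes>\<^sub>M S) S ?c) ?X"
    by (simp add: PiM_comb_seq)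
  also have "\<dots> = emeasure (S \<Otimes>\<^sub>M S) (?c -` ?X \<inter> space (S \<Otimes>\<^sub>M S))"
    using c X by (rule emeasure_distr)
  also have "\<dots> = (\<integral>\<^sup>+ \<omega>. emeasure S (Pair \<omega> -` (?c -` ?X \<inter> space (S \<Otimes>\<^sub>M S))) \<partial>S)"
    using measurable_sets[OF c X] by (rule P.emeasure_pair_measure_alt)
  also have "\<dots> = (\<integral>\<^sup>+ \<omega>. indicator {b. E b} \<omega> * emeasure S {b. A b} \<partial>S)"
  proof (rule nn_integral_cong)
    fix \<omega>
    have agree: "E (comb_seq k \<omega> \<omega>') = E \<omega>" "loc (comb_seq k \<omega> \<omega>') = loc \<omega>" for \<omega>'
      by (rule E loc, simp add: comb_seq_def)+
    have "seen_from k x (comb_seq k \<omega> \<omega>') = seen_from 0 x \<omega>'" for x \<omega>'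
      by (simp add: seen_from_def comb_seq_def)
    then have "Pair \<omega> -` (?c -` ?X \<inter> space (S \<Otimes>\<^sub>M S))
        = (if E \<omega> then seen_from 0 (loc \<omega>) -` {b. A b} \<inter> space S else {})"
      by (auto simp: agree space_pair_measure)
    moreover have "emeasure S (seen_from 0 (loc \<omega>) -` {b. A b} \<inter> space S) = emeasure S {b. A b}"
    proof -
      have "Measurable.pred S A" by measurable
      then have "{b. A b} \<in> sets S" by (simp add: pred_def)
      moreover have "seen_from 0 (loc \<omega>) \<in> measurable S S" by measurable
      ultimately have "emeasure S (seen_from 0 (loc \<omega>) -` {b. A b} \<inter> space S)
          = emeasure (distr S S (seen_from 0 (loc \<omega>))) {b. A b}"
        by (simp only: emeasure_distr)
      then show ?thesis by (simp only: distr_translate)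
    qed
    ultimately show "emeasure S (Pair \<omega> -` (?c -` ?X \<inter> space (S \<Otimes>\<^sub>M S)))
        = indicator {b. E b} \<omega> * emeasure S {b. A b}"
      by (simp split: split_indicator)
  qed
  also have "\<dots> = emeasure S {b. E b} * emeasure S {b. A b}"
  proof -
    have "Measurable.pred S E" by measurable
    then have "{b. E b} \<in> sets S" by (simp add: pred_def)
    then show ?thesis by (simp add: nn_integral_multc)
  qed
  finally show ?thesis .
qed

lemma measure_markov:
  assumes [measurable]: "Measurable.pred env_space E" "Measurable.pred env_space A"
  assumes E: "\<And>b b'. (\<And>n. n < k \<Longrightarrow> b n = b' n) \<Longrightarrow> E b = E b'"
  shows "measure S {b. E b \<and> A (env_at t k b)} = measure S {b. E b} * measure S {b. A b}"
proof -
  have "emeasure S {b. E b \<and> A (seen_from k (leftmost t k b) b)} = emeasure S {b. E b} * emeasure S {b. A b}"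
  proof (rule markov)
    show "E b = E b'" "leftmost t k b = leftmost t k b'" if "\<And>n. n < k \<Longrightarrow> b n = b' n" for b b'
      using E[OF that] leftmost_cong[OF that] by auto
  qed measurable
  then show ?thesis
    by (simp add: env_at_def measure_def enn2real_mult)
qed

lemma distr_seen_from: "distr S S (seen_from k x) = S"
proof (rule measure_eqI)
  fix A assume "A \<in> sets (distr S S (seen_from k x))"
  then have A: "A \<in> sets S" by simp
  then have [measurable]: "Measurable.pred env_space (\<lambda>b. b \<in> A)"
    by (simp add: pred_def sets_S[symmetric])
  have s: "seen_from k x \<in> measurable S S" by measurable
  have "emeasure S {b. True \<and> seen_from k x b \<in> A} = emeasure S {b. True} * emeasure S {b. b \<in> A}"
    by (rule markov) auto
  moreover have "emeasure S UNIV = 1"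
    using P.emeasure_space_1 by simp
  ultimately show "emeasure (distr S S (seen_from k x)) A = emeasure S A"
    using A s by (simp add: emeasure_distr vimage_def)
qed simp

section \<open>Approximation by cylinder sets\<close>

definition cylinder :: "nat \<Rightarrow> (nat \<Rightarrow> 'd lmatrix) set \<Rightarrow> bool" where
  "cylinder k C \<longleftrightarrow> C \<in> sets S \<and> (\<forall>b b'. (\<forall>n<k. b n = b' n) \<longrightarrow> (b \<in> C \<longleftrightarrow> b' \<in> C))"

definition cylinder_approx :: "(nat \<Rightarrow> 'd lmatrix) set \<Rightarrow> bool" where
  "cylinder_approx X \<longleftrightarrow>
    (\<forall>e>0. \<exists>k C. cylinder k C \<and> measure S (X - C) + measure S (C - X) < e)"

text \<open>The events approximable in symmetric difference form a sigma-algebra containing the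
  events of one coordinate. A countable union is truncated to \<open>n\<close> sets at cost
  \<open>e / 2\<close>, and the \<open>n\<close> sets share the other half; dividing by
  \<open>n + 1\<close> keeps their tolerance positive when \<open>n = 0\<close>.\<close>

lemma cylinder_approx: "X \<in> sets S \<Longrightarrow> cylinder_approx X"
proof -
  let ?G = "{{f \<in> \<Pi>\<^sub>E i\<in>UNIV. space M. f i \<in> A} |i A. i \<in> (UNIV::nat set) \<and> A \<in> sets M}"
  assume X: "X \<in> sets S"
  then have "X \<in> sigma_sets (\<Pi>\<^sub>E i\<in>UNIV. space M) ?G"
    by (simp only: sets_PiM_single)
  then have "X \<in> sets S \<and> cylinder_approx X"
  proof induction
    case (Basic a)
    then obtain i A where a: "a = {f. f i \<in> A}" and A: "A \<in> sets M"
      by (auto simp: PiE_def)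
    have "(\<lambda>f. f i) \<in> measurable S M" by measurable
    from measurable_sets[OF this A] have "a \<in> sets S"
      by (simp add: a vimage_def)
    moreover from this have "cylinder (Suc i) a"
      by (auto simp: cylinder_def a)
    then have "cylinder_approx a"
      unfolding cylinder_approx_def by (intro allI impI exI[of _ "Suc i"] exI[of _ a]) simp
    ultimately show ?case by simp
  next
    case Empty
    have "cylinder 0 {}"
      by (simp add: cylinder_def)
    then have "cylinder_approx {}"
      unfolding cylinder_approx_def by (intro allI impI exI[of _ 0] exI[of _ "{}"]) simp
    then show ?case by simp
  next
    case (Compl a)
    have eq: "(\<Pi>\<^sub>E i\<in>UNIV. space M) - a = - a" by auto
    have "- a \<in> sets S"
      using Compl.IH sets.compl_sets[of a S] by (simp add: Compl_eq_Diff_UNIV)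
    moreover have "cylinder_approx (- a)"
      unfolding cylinder_approx_def
    proof (intro allI impI)
      fix e :: real assume "0 < e"
      then obtain k C where C: "cylinder k C" "measure S (a - C) + measure S (C - a) < e"
        using Compl.IH unfolding cylinder_approx_def by blast
      have "- C \<in> sets S"
        using C(1) sets.compl_sets[of C S] by (simp add: cylinder_def Compl_eq_Diff_UNIV)
      then have "cylinder k (- C)"
        using C(1) by (auto simp: cylinder_def)
      moreover have "- a - - C = C - a" "- C - - a = a - C" by auto
      ultimately show "\<exists>k C. cylinder k C \<and> measure S (- a - C) + measure S (C - - a) < e"
        using C(2) by (intro exI[of _ k] exI[of _ "- C"]) (simp add: add.commute)
    qed
    ultimately show ?case by (simp only: eq)
  next
    case (Union a)
    then have a: "a i \<in> sets S" for i by simp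
    then have UN: "(\<Union>i. a i) \<in> sets S" by auto
    moreover have "cylinder_approx (\<Union>i. a i)"
      unfolding cylinder_approx_def
    proof (intro allI impI)
      fix e :: real assume e: "0 < e"
      have "(\<lambda>n. measure S (\<Union>i<n. a i)) \<longlonglongrightarrow> measure S (\<Union>n. \<Union>i<n. a i)"
        using a by (intro P.finite_Lim_measure_incseq) (auto simp: incseq_def intro!: less_le_trans)
      moreover have "(\<Union>n. \<Union>i<n. a i) = (\<Union>i. a i)" by auto
      ultimately have "(\<lambda>n. measure S (\<Union>i<n. a i)) \<longlonglongrightarrow> measure S (\<Union>i. a i)" by simp
      then have "eventually (\<lambda>n. measure S (\<Union>i. a i) - e / 2 < measure S (\<Union>i<n. a i)) sequentially"
        using e by (intro order_tendstoD(1)[of _ "measure S (\<Union>i. a i)"]) auto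
      then obtain n where n: "measure S (\<Union>i. a i) - e / 2 < measure S (\<Union>i<n. a i)"
        by (auto simp: eventually_sequentially)
      have "measure S ((\<Union>i. a i) - (\<Union>i<n. a i)) = measure S (\<Union>i. a i) - measure S (\<Union>i<n. a i)"
        using a UN by (intro P.finite_measure_Diff) auto
      with n have tail: "measure S ((\<Union>i. a i) - (\<Union>i<n. a i)) < e / 2" by simp
      have "\<exists>k C. cylinder k C \<and> measure S (a i - C) + measure S (C - a i) < e / (2 * (real n + 1))" for i
      proof -
        have "0 < e / (2 * (real n + 1))" using e by simp
        then show ?thesis using Union.IH[of i] unfolding cylinder_approx_def by blast
      qed
      then obtain k C where kC: "\<And>i. cylinder (k i) (C i)"
        and small: "\<And>i. measure S (a i - C i) + measure S (C i - a i) < e / (2 * (real n + 1))"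
        by metis
      have C: "\<And>i. C i \<in> sets S"
        using kC by (simp add: cylinder_def)
      define D where "D = (\<Union>i<n. C i)"
      have D: "D \<in> sets S" unfolding D_def using C by auto
      define K where "K = (\<Sum>i<n. k i)"
      have K: "k i \<le> K" if "i < n" for i
        unfolding K_def using that by (intro member_le_sum) auto
      have "cylinder K D"
        unfolding cylinder_def
      proof (intro conjI allI impI)
        fix b b' :: "nat \<Rightarrow> 'd lmatrix" assume *: "\<forall>n<K. b n = b' n"
        have "b \<in> C i \<longleftrightarrow> b' \<in> C i" if "i < n" for i
        proof -
          have "\<forall>n<k i. b n = b' n" using * K[OF that] by auto
          then show ?thesis using kC[of i] unfolding cylinder_def by blast
        qed
        then show "b \<in> D \<longleftrightarrow> b' \<in> D" by (auto simp: D_def)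
      qed fact
      moreover have "measure S ((\<Union>i. a i) - D) + measure S (D - (\<Union>i. a i)) < e"
      proof -
        have "measure S ((\<Union>i. a i) - D) \<le> measure S (((\<Union>i. a i) - (\<Union>i<n. a i)) \<union> (\<Union>i<n. a i - C i))"
          using a C UN D by (intro P.finite_measure_mono) (auto simp: D_def)
        also have "\<dots> \<le> measure S ((\<Union>i. a i) - (\<Union>i<n. a i)) + measure S (\<Union>i<n. a i - C i)"
          using a C UN by (intro measure_Un_le) auto
        also have "measure S (\<Union>i<n. a i - C i) \<le> (\<Sum>i<n. measure S (a i - C i))"
          using a C by (intro P.finite_measure_subadditive_finite) auto
        finally have 1: "measure S ((\<Union>i. a i) - D) \<le>
          measure S ((\<Union>i. a i) - (\<Union>i<n. a i)) + (\<Sum>i<n. measure S (a i - C i))" by simp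
        have "measure S (D - (\<Union>i. a i)) \<le> measure S (\<Union>i<n. C i - a i)"
          using a C UN D by (intro P.finite_measure_mono) (auto simp: D_def)
        also have "\<dots> \<le> (\<Sum>i<n. measure S (C i - a i))"
          using a C by (intro P.finite_measure_subadditive_finite) auto
        finally have "measure S ((\<Union>i. a i) - D) + measure S (D - (\<Union>i. a i))
          < e / 2 + (\<Sum>i<n. measure S (a i - C i) + measure S (C i - a i))"
          using 1 tail by (simp add: sum.distrib)
        also have "(\<Sum>i<n. measure S (a i - C i) + measure S (C i - a i)) \<le> (\<Sum>i<n. e / (2 * (real n + 1)))"
          by (intro sum_mono less_imp_le small)
        also have "\<dots> \<le> e / 2"
          using e by (simp add: field_simps)
        finally show ?thesis by simp
      qed
      ultimately show "\<exists>k C. cylinder k C \<and> measure S ((\<Union>i. a i) - C) + measure S (C - (\<Union>i. a i)) < e"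
        by blast
    qed
    ultimately show ?case by simp
  qed
  then show ?thesis by simp
qed

section \<open>Renewals: existence, law and mean gap\<close>

abbreviation surv_prob :: real where
  "surv_prob \<equiv> measure S {b. surv b}"

lemma pred_sets_S: "Measurable.pred env_space A \<Longrightarrow> {b. A b} \<in> sets S"
  by (simp add: pred_def sets_S)

lemma pred_env_at:
  assumes "Measurable.pred env_space A"
  shows "Measurable.pred env_space (\<lambda>b. A (env_at t k b))"
  by (rule measurable_compose[OF env_at_measurable assms])

lemma pred_renew:
  assumes "Measurable.pred env_space A"
  shows "Measurable.pred env_space (\<lambda>b. A (renew t b))"
  by (rule measurable_compose[OF renew_measurable assms])

text \<open>A zero-one argument: given the first \<open>k\<close> matrices and an alive generation \<open>k\<close>, some later
  leftmost vertex survives with probability at least \<open>surv_prob\<close>, so an event on which the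
  population survives but no leftmost vertex does cannot be approximated by cylinders unless it is null.\<close>

lemma AE_next_surv:
  assumes p: "0 < surv_prob"
  shows "AE b in S. surv b \<longrightarrow> (\<exists>j>0. surv (env_at t j b))"
proof -
  let ?V = "\<lambda>b. \<exists>j>0. surv (env_at t j b)"
  define X :: "(nat \<Rightarrow> 'd lmatrix) set" where "X = {b. surv b \<and> \<not> ?V b}"
  have X: "X \<in> sets S"
    unfolding X_def by (rule pred_sets_S) measurable
  have "measure S X \<le> e * (1 + 1 / surv_prob)" if "0 < e" for e
  proof -
    obtain k C where kC: "cylinder k C" and C: "measure S (X - C) + measure S (C - X) < e"
      using cylinder_approx[OF X] \<open>0 < e\<close> unfolding cylinder_approx_def by blast
    have C_sets: "C \<in> sets S"
      using kC by (simp add: cylinder_def)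
    \<comment> \<open>Depth \<open>Suc k\<close> instead of \<open>k\<close>, because a leftmost
      survivor contradicts \<open>X\<close> only at positive depth, and \<open>k\<close> may be
      0.\<close>
    define E where "E b \<longleftrightarrow> b \<in> C \<and> alive (Suc k) b" for b
    have [measurable]: "Measurable.pred env_space (\<lambda>b. b \<in> C)"
      using C_sets by (simp add: pred_def sets_S)
    have E [measurable]: "Measurable.pred env_space E"
      unfolding E_def[abs_def] by measurable
    have "measure S {b. E b} * surv_prob = measure S {b. E b \<and> surv (env_at t (Suc k) b)}"
    proof (rule measure_markov[symmetric])
      fix b b' :: "nat \<Rightarrow> 'd lmatrix" assume "\<And>n. n < Suc k \<Longrightarrow> b n = b' n"
      then show "E b = E b'"
        using kC[unfolded cylinder_def, THEN conjunct2, rule_format, of b b'] alive_cong[of "Suc k" b b'] by (simp add: E_def del: alive.simps)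
    qed measurable
    \<comment> \<open>A survivor at depth \<open>Suc k\<close> puts \<open>b\<close> outside
      \<open>X\<close>, so this event costs less than \<open>e\<close>, and dividing by
      \<open>surv_prob\<close> shows that \<open>E\<close> itself is small. But \<open>X\<close> is
      contained in \<open>E\<close> up to the small set \<open>X - C\<close>.\<close>
    also have "\<dots> \<le> measure S (C - X)"
      using C_sets X by (intro P.finite_measure_mono) (auto simp: E_def X_def)
    finally have "measure S {b. E b} \<le> measure S (C - X) / surv_prob"
      using p by (simp add: field_simps)
    also have "\<dots> \<le> e / surv_prob"
      using C p measure_nonneg[of S "X - C"] by (intro divide_right_mono) linarith+
    finally have "measure S {b. E b} \<le> e / surv_prob" .
    moreover have "measure S X \<le> measure S ({b. E b} \<union> (X - C))"
      using C_sets X E[THEN pred_sets_S]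
      by (intro P.finite_measure_mono) (auto simp: E_def X_def surv_def simp del: alive.simps)
    moreover have "\<dots> \<le> measure S {b. E b} + measure S (X - C)"
      using C_sets X E[THEN pred_sets_S] by (intro measure_Un_le) auto
    moreover have "measure S (X - C) < e"
      using C measure_nonneg[of S "C - X"] by linarith
    ultimately show ?thesis by (simp add: algebra_simps)
  qed
  note bound = this
  have "measure S X \<le> 0"
  proof (rule field_le_epsilon)
    fix e :: real assume "0 < e"
    moreover have "0 < 1 + 1 / surv_prob" using p by (simp add: add_pos_pos)
    ultimately show "measure S X \<le> 0 + e"
      using bound[of "e / (1 + 1 / surv_prob)"] by simp
  qed
  then have "X \<in> null_sets S"
    using X measure_nonneg[of S X] by (auto simp: null_sets_def P.emeasure_eq_measure)
  then have "AE b in S. b \<notin> X"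
    by (rule AE_not_in)
  then show ?thesis
    by eventually_elim (auto simp: X_def)
qed

text \<open>Every space-time shift preserves the law, so \<open>AE_next_surv\<close> holds at each
  of the countably many points.\<close>

lemma AE_hereditary:
  assumes p: "0 < surv_prob"
  shows "AE b in S. hereditary t b"
  unfolding hereditary_def
proof (intro AE_all_countable[THEN iffD2] allI)
  fix k :: nat and x :: "'d lattice"
  have s: "seen_from k x \<in> measurable S S" by measurable
  have "AE b in distr S S (seen_from k x). surv b \<longrightarrow> (\<exists>j>0. surv (env_at t j b))"
    using AE_next_surv[OF p] by (simp only: distr_seen_from)
  then show "AE b in S. surv (seen_from k x b) \<longrightarrow> (\<exists>j>0. surv (env_at t j (seen_from k x b)))"
    by (rule AE_distrD[OF s])
qed

text \<open>Decomposition by the value of the gap. By \<open>next_surv_eq_iff\<close> each piece is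
  an event of the first \<open>Suc k\<close> matrices together with survival from the leftmost
  vertex, so it factorises by \<open>measure_markov\<close>. The parameter \<open>Z\<close> is an
  arbitrary condition on the gap and on heaviness; the latter concerns the first matrix
  only.\<close>

lemma first_renewal:
  fixes Z :: "nat \<Rightarrow> bool \<Rightarrow> bool"
  assumes p: "0 < surv_prob" and A [measurable]: "Measurable.pred env_space A"
  shows "(\<lambda>k. measure S {b. new_start t (Suc k) b \<and> Z (Suc k) (heavy t b)} * measure S {b. surv b \<and> A b})
    sums measure S {b. surv b \<and> Z (next_surv t b) (heavy t b) \<and> A (renew t b)}"
proof -
  let ?X = "{b. surv b \<and> Z (next_surv t b) (heavy t b) \<and> A (renew t b)}"
  define Y where "Y k = {b. (new_start t (Suc k) b \<and> Z (Suc k) (heavy t b)) \<and>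
    (surv (env_at t (Suc k) b) \<and> A (env_at t (Suc k) b))}" for k
  note pred_env_at[OF A, measurable] pred_renew[OF A, measurable]
  have Y_sets: "Y k \<in> sets S" for k
    unfolding Y_def by (rule pred_sets_S) measurable
  have Y_eq: "Y k = {b. surv b \<and> surv (env_at t (Suc k) b) \<and> next_surv t b = Suc k \<and>
      Z (Suc k) (heavy t b) \<and> A (env_at t (Suc k) b)}" for k
    using next_surv_eq_iff[of "Suc k" _ t] by (auto simp: Y_def)
  have "disjoint_family Y"
    by (auto simp: disjoint_family_on_def Y_eq)
  then have "(\<lambda>k. measure S (Y k)) sums measure S (\<Union>k. Y k)"
    using Y_sets by (intro P.finite_measure_UNION) auto
  moreover have "measure S (Y k) =
      measure S {b. new_start t (Suc k) b \<and> Z (Suc k) (heavy t b)} * measure S {b. surv b \<and> A b}" for k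
    unfolding Y_def
  proof (rule measure_markov)
    fix b b' :: "nat \<Rightarrow> 'd lmatrix" assume *: "\<And>n. n < Suc k \<Longrightarrow> b n = b' n"
    show "(new_start t (Suc k) b \<and> Z (Suc k) (heavy t b)) = (new_start t (Suc k) b' \<and> Z (Suc k) (heavy t b'))"
      using new_start_cong[of "Suc k" b b' t] * *[of 0] by (auto simp: heavy_def)
  qed measurable
  moreover have "measure S (\<Union>k. Y k) = measure S ?X"
  proof (rule P.finite_measure_eq_AE)
    show "AE b in S. b \<in> (\<Union>k. Y k) \<longleftrightarrow> b \<in> ?X"
      using AE_hereditary[OF p, of t]
    proof eventually_elim
      case (elim b)
      show ?case
      proof
        assume "b \<in> (\<Union>k. Y k)"
        then show "b \<in> ?X" by (auto simp: Y_eq renew_def)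
      next
        assume b: "b \<in> ?X"
        then obtain k where "next_surv t b = Suc k" "surv (renew t b)"
          using hereditary_renew(1,2)[OF elim] by (auto simp: gr0_conv_Suc)
        then show "b \<in> (\<Union>k. Y k)"
          using b by (auto simp: Y_eq renew_def)
      qed
    qed
    show "?X \<in> sets S" by (rule pred_sets_S) measurable
  qed (use Y_sets in auto)
  ultimately show ?thesis by simp
qed

text \<open>The series of \<open>first_renewal\<close> for \<open>A\<close> and for the sure event
  have the same weights, so their sums are proportional. In terms of the law conditioned on
  survival: the renewed environment again has this law, and it is independent of the gap and of
  heaviness.\<close>

lemma renewal_law:
  assumes p: "0 < surv_prob" and A [measurable]: "Measurable.pred env_space A"
  shows "measure S {b. surv b \<and> A (renew t b)} = measure S {b. surv b \<and> A b}"
    and "measure S {b. surv b \<and> Z (next_surv t b) (heavy t b) \<and> A (renew t b)} * surv_prob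
      = measure S {b. surv b \<and> Z (next_surv t b) (heavy t b)} * measure S {b. surv b \<and> A b}"
proof -
  have *: "measure S {b. surv b \<and> Z (next_surv t b) (heavy t b) \<and> A (renew t b)} * surv_prob
      = measure S {b. surv b \<and> Z (next_surv t b) (heavy t b)} * measure S {b. surv b \<and> A b}"
    if A [measurable]: "Measurable.pred env_space A" for Z :: "nat \<Rightarrow> bool \<Rightarrow> bool" and A
  proof -
    let ?w = "\<lambda>k. measure S {b. new_start t (Suc k) b \<and> Z (Suc k) (heavy t b)}"
    have 1: "(\<lambda>k. ?w k * surv_prob) sums measure S {b. surv b \<and> Z (next_surv t b) (heavy t b)}"
      using first_renewal[OF p, of "\<lambda>_. True" t Z] by simp
    have 2: "(\<lambda>k. ?w k * measure S {b. surv b \<and> A b})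
        sums measure S {b. surv b \<and> Z (next_surv t b) (heavy t b) \<and> A (renew t b)}"
      by (rule first_renewal[OF p that])
    show ?thesis
      using sums_unique2[OF sums_mult2[OF 1, of "measure S {b. surv b \<and> A b}"] ] sums_mult2[OF 2, of surv_prob]
      by (simp add: ac_simps)
  qed
  show "measure S {b. surv b \<and> Z (next_surv t b) (heavy t b) \<and> A (renew t b)} * surv_prob
      = measure S {b. surv b \<and> Z (next_surv t b) (heavy t b)} * measure S {b. surv b \<and> A b}"
    by (rule *[OF A])
  show "measure S {b. surv b \<and> A (renew t b)} = measure S {b. surv b \<and> A b}"
    using *[OF A, of "\<lambda>_ _. True"] p by simp
qed

text \<open>At depth 1 there are no intermediate vertices, so \<open>new_start\<close> reduces to
  \<open>alive\<close>, which follows from a heavy entry because \<open>1 \<le> t\<close>. Survival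
  of the leftmost child is independent of the first matrix.\<close>

lemma heavy_renewal:
  assumes p: "0 < surv_prob" and t: "1 \<le> t"
  shows "measure S {b. surv b \<and> next_surv t b = 1 \<and> heavy t b} = measure S {b. heavy t b} * surv_prob"
proof -
  let ?Z = "\<lambda>k c. k = 1 \<and> c"
  have "(\<lambda>k. measure S {b. new_start t (Suc k) b \<and> Suc k = 1 \<and> heavy t b} * surv_prob)
      sums measure S {b. surv b \<and> next_surv t b = 1 \<and> heavy t b}"
    using first_renewal[OF p, of "\<lambda>_. True" t ?Z] by simp
  moreover have "(\<lambda>k. measure S {b. new_start t (Suc k) b \<and> Suc k = 1 \<and> heavy t b} * surv_prob)
      sums (measure S {b. new_start t (Suc 0) b \<and> heavy t b} * surv_prob)"
    using sums_If_finite_set[of "{0}" "\<lambda>k. measure S {b. new_start t (Suc k) b \<and> Suc k = 1 \<and> heavy t b} * surv_prob"]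
    by (auto elim!: sums_cong[THEN iffD1, rotated])
  moreover have "new_start t (Suc 0) b \<and> heavy t b \<longleftrightarrow> heavy t b" for b :: "nat \<Rightarrow> 'd lmatrix"
    using t by (auto simp: new_start_def heavy_def intro: order_trans)
  ultimately show ?thesis
    by (simp add: sums_unique2)
qed

text \<open>Decomposition at the last renewal up to time \<open>n\<close>: \<open>Q i\<close> says
  that depth \<open>n - i\<close> is a renewal and that the next one comes after \<open>n\<close>.
  These events are disjoint and imply survival, so their probabilities add up to at most
  \<open>surv_prob\<close>. Each of them factorises, and its first factor, the probability of being
  alive at depth \<open>n - i\<close>, is at least \<open>surv_prob\<close>. After conditioning on
  survival the bound 1 becomes \<open>1 / surv_prob\<close> for the mean gap.\<close>

lemma sum_next_surv_tail:
  assumes p: "0 < surv_prob"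
  shows "(\<Sum>i<n. measure S {b. surv b \<and> i < next_surv t b}) \<le> 1"
proof -
  define Q :: "nat \<Rightarrow> (nat \<Rightarrow> 'd lmatrix) set"
    where "Q i = {b. alive (n - i) b \<and> surv (env_at t (n - i) b) \<and> i < next_surv t (env_at t (n - i) b)}" for i
  have meas: "Measurable.pred env_space (\<lambda>b. surv b \<and> i < next_surv t b)" for i
    by measurable
  have [measurable]: "Measurable.pred env_space (\<lambda>b. surv (env_at t j b) \<and> i < next_surv t (env_at t j b))" for i j
    using pred_env_at[OF meas] .
  have Q: "Q i \<in> sets S" for i
    unfolding Q_def by (rule pred_sets_S) measurable
  have Q_measure: "measure S (Q i) = measure S {b. alive (n - i) b} * measure S {b. surv b \<and> i < next_surv t b}" for i
    unfolding Q_def using alive_cong by (intro measure_markov) (auto intro: meas)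
  have False if b: "b \<in> Q i" "b \<in> Q j" and ij: "i < j" "j < n" for b i j
  proof -
    define b1 where "b1 = env_at t (n - j) b"
    have b1: "alive (n - j) b" "surv b1" "j < next_surv t b1" "surv (env_at t (n - i) b)"
      using b by (auto simp: Q_def b1_def)
    have "env_at t (n - i) b = env_at t (j - i) b1"
      using env_at_add[of "n - j" b "j - i" t] b1 ij by (simp add: b1_def surv_def)
    then have "next_surv t b1 \<le> j - i"
      unfolding next_surv_def using b1 ij by (intro Least_le) simp
    with b1 show False by simp
  qed
  then have "disjoint_family_on Q {..<n}"
    unfolding disjoint_family_on_def by (metis disjoint_iff lessThan_iff linorder_neqE_nat)
  then have "(\<Sum>i<n. measure S (Q i)) = measure S (\<Union>i<n. Q i)"
    using Q by (intro P.finite_measure_finite_Union[symmetric]) auto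
  also have "\<dots> \<le> surv_prob"
    using Q by (intro P.finite_measure_mono pred_sets_S surv_measurable)
      (auto simp: Q_def intro: surv_env_at)
  finally have "(\<Sum>i<n. measure S (Q i)) \<le> surv_prob" .
  moreover have "surv_prob * measure S {b. surv b \<and> i < next_surv t b} \<le> measure S (Q i)" for i
    unfolding Q_measure
    by (intro mult_right_mono P.finite_measure_mono pred_sets_S alive_measurable) (auto simp: surv_def)
  then have "surv_prob * (\<Sum>i<n. measure S {b. surv b \<and> i < next_surv t b}) \<le> (\<Sum>i<n. measure S (Q i))"
    unfolding sum_distrib_left by (intro sum_mono)
  ultimately have "surv_prob * (\<Sum>i<n. measure S {b. surv b \<and> i < next_surv t b}) \<le> surv_prob * 1"
    by simp
  then show ?thesis
    using p by (simp only: mult_le_cancel_left_pos)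
qed

text \<open>Given survival, \<open>f\<close> has mean at most \<open>\<alpha> / surv_prob\<close>
  minus the probability of a heavy entry. The strict upper bound on \<alpha> makes this negative, as
  the maximal argument demands.\<close>

lemma AE_heavy_steps:
  assumes p: "0 < surv_prob" and t: "1 \<le> t"
    and \<alpha>: "0 \<le> \<alpha>" "\<alpha> < surv_prob * measure S {b. heavy t b}"
  shows "AE b in S. surv b \<longrightarrow> (\<exists>C. \<forall>n. \<alpha> * real n - C \<le> real (heavy_steps t n b))"
proof -
  define U where "U = uniform_measure S {b. surv b}"
  have em: "emeasure S {b. surv b} \<noteq> 0" "emeasure S {b. surv b} \<noteq> \<infinity>"
    using p by (auto simp: P.emeasure_eq_measure)
  have sets_U [measurable_cong]: "sets U = sets env_space"
    by (simp add: U_def sets_S)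
  have space_U: "space U = UNIV"
    by (simp add: U_def)
  interpret U: prob_space U
    unfolding U_def using em by (rule prob_space_uniform_measure)
  have U_measure: "measure U {b. A b} = measure S {b. surv b \<and> A b} / surv_prob"
    if "Measurable.pred env_space A" for A
  proof -
    have "{b. surv b} \<inter> {b. A b} = {b. surv b \<and> A b}" by auto
    then show ?thesis
      unfolding U_def using measure_uniform_measure[OF em pred_sets_S[OF that]] by simp
  qed
  define f :: "(nat \<Rightarrow> 'd lmatrix) \<Rightarrow> real"
    where "f b = \<alpha> * real (next_surv t b) - of_bool (next_surv t b = 1 \<and> heavy t b)" for b
  have f_meas [measurable]: "f \<in> borel_measurable U"
    unfolding f_def by measurable
  have renew_meas [measurable]: "renew t \<in> measurable U U"
    by measurable
  have inv: "distr U U (renew t) = U"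
  proof (rule measure_eqI)
    fix A assume "A \<in> sets (distr U U (renew t))"
    then have A: "A \<in> sets U" by simp
    then have A' [measurable]: "Measurable.pred env_space (\<lambda>b. b \<in> A)"
      by (simp add: pred_def sets_U)
    have "emeasure (distr U U (renew t)) A = emeasure U {b. renew t b \<in> A}"
      using A by (subst emeasure_distr) (auto simp: space_U vimage_def)
    also have "\<dots> = emeasure U A"
      using renewal_law(1)[OF p A', of t] U_measure[OF A'] U_measure[OF pred_renew[OF A', of t]]
      by (simp add: U.emeasure_eq_measure)
    finally show "emeasure (distr U U (renew t)) A = emeasure U A" .
  qed simp
  have ind: "U.indep_var borel f borel (\<lambda>b. indicat_real A (renew t b))" if A: "A \<in> sets U" for A
  proof (rule U.indep_varI)
    show "f \<in> borel_measurable U" by (rule f_meas)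
    show "(\<lambda>b. indicat_real A (renew t b)) \<in> borel_measurable U"
      using A by (intro measurable_compose[OF renew_meas]) simp
    fix X Y :: "real set" assume [measurable]: "X \<in> sets borel" "Y \<in> sets borel"
    \<comment> \<open>The function \<open>f\<close> sees the environment only through the gap and
      heaviness, the two arguments for which \<open>renewal_law\<close> gives independence.\<close>
    define Z where "Z k c \<longleftrightarrow> \<alpha> * real k - of_bool (k = 1 \<and> c) \<in> X" for k c
    define A' where "A' b \<longleftrightarrow> indicat_real A b \<in> Y" for b
    have fX: "f b \<in> X \<longleftrightarrow> Z (next_surv t b) (heavy t b)" for b
      by (simp add: f_def Z_def)
    have Z_meas: "Measurable.pred env_space (\<lambda>b. Z (next_surv t b) (heavy t b))"
      unfolding fX[symmetric] f_def by measurable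
    have [measurable]: "A \<in> sets env_space" using A by (simp add: sets_U)
    have A'_meas [measurable]: "Measurable.pred env_space A'"
      unfolding A'_def by measurable
    note pred_renew[OF A'_meas, measurable] Z_meas [measurable]
    have ZA'_meas: "Measurable.pred env_space (\<lambda>b. Z (next_surv t b) (heavy t b) \<and> A' (renew t b))"
      by measurable
    have "measure S {b. surv b \<and> Z (next_surv t b) (heavy t b) \<and> A' (renew t b)} / surv_prob
      = measure S {b. surv b \<and> Z (next_surv t b) (heavy t b)} / surv_prob
        * (measure S {b. surv b \<and> A' (renew t b)} / surv_prob)"
      using renewal_law(1)[OF p A'_meas, of t] renewal_law(2)[OF p A'_meas, of Z t] p
      by (simp add: field_simps)
    then show "U.prob {b \<in> space U. f b \<in> X \<and> indicat_real A (renew t b) \<in> Y}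
      = U.prob {b \<in> space U. f b \<in> X} * U.prob {b \<in> space U. indicat_real A (renew t b) \<in> Y}"
      using U_measure[OF ZA'_meas] U_measure[OF Z_meas] U_measure[OF pred_renew[OF A'_meas, of t]]
      by (simp add: space_U fX A'_def[symmetric])
  qed
  \<comment> \<open>The mean gap is the sum of these tails, so bounding their partial sums yields
    integrability as well as the bound on the mean.\<close>
  let ?u = "\<lambda>i. U.prob {b. i < next_surv t b}"
  have "(\<Sum>i<n. ?u i) \<le> 1 / surv_prob" for n
  proof -
    have "(\<Sum>i<n. ?u i) = (\<Sum>i<n. measure S {b. surv b \<and> i < next_surv t b}) / surv_prob"
      by (subst U_measure) (simp_all add: sum_divide_distrib)
    then show ?thesis
      using sum_next_surv_tail[OF p] p by (simp add: divide_right_mono)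
  qed
  note u_le = this
  have u_summable: "summable ?u"
    by (rule bounded_imp_summable[where B="1 / surv_prob"]) (use u_le[of "Suc _"] in \<open>auto simp: lessThan_Suc_atMost\<close>)
  have "(\<integral>\<^sup>+ b. of_nat (next_surv t b) \<partial>U) = (\<Sum>i. emeasure U {b \<in> space U. i < next_surv t b})"
    by (rule nn_integral_nat_function) measurable
  also have "\<dots> = ennreal (suminf ?u)"
    using u_summable by (simp add: space_U U.emeasure_eq_measure suminf_ennreal2)
  finally have nn: "(\<integral>\<^sup>+ b. ennreal (real (next_surv t b)) \<partial>U) = ennreal (suminf ?u)"
    by (simp add: ennreal_of_nat_eq_real_of_nat)
  have int: "integrable U (\<lambda>b. real (next_surv t b))"
    by (rule integrableI_nn_integral_finite[OF _ _ nn]) auto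
  have "(\<integral>b. real (next_surv t b) \<partial>U) = suminf ?u"
    using nn u_summable by (subst integral_eq_nn_integral) (auto simp: suminf_nonneg)
  also have "\<dots> \<le> 1 / surv_prob"
    using u_summable u_le by (rule suminf_le_const)
  finally have mean: "(\<integral>b. real (next_surv t b) \<partial>U) \<le> 1 / surv_prob" .
  have h_meas [measurable]: "Measurable.pred env_space (\<lambda>b. next_surv t b = 1 \<and> heavy t b)"
    by measurable
  have of_bool_eq: "(\<lambda>b. of_bool (next_surv t b = 1 \<and> heavy t b) :: real) = indicator {b. next_surv t b = 1 \<and> heavy t b}"
    by (auto simp: indicator_def)
  have h_sets: "{b. next_surv t b = 1 \<and> heavy t b} \<in> sets U"
    using h_meas by (simp add: pred_def sets_U)
  have int_h: "integrable U (\<lambda>b. of_bool (next_surv t b = 1 \<and> heavy t b) :: real)"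
    unfolding of_bool_eq
    by (rule integrable_real_indicator[OF h_sets]) (simp add: U.emeasure_eq_measure)
  have mean_h: "(\<integral>b. of_bool (next_surv t b = 1 \<and> heavy t b) \<partial>U) = measure S {b. heavy t b}"
    unfolding of_bool_eq using h_sets heavy_renewal[OF p t] U_measure[OF h_meas] p by simp
  have "AE b in U. \<exists>C. \<forall>n. (\<Sum>i<n. f ((renew t ^^ i) b)) \<le> C"
  proof (rule U.AE_partial_sums_bounded_above)
    show "integrable U f"
      unfolding f_def using int int_h by simp
    have "(\<integral>b. f b \<partial>U) = \<alpha> * (\<integral>b. real (next_surv t b) \<partial>U) - measure S {b. heavy t b}"
      unfolding f_def using int int_h mean_h by simp
    also have "\<dots> \<le> \<alpha> * (1 / surv_prob) - measure S {b. heavy t b}"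
      using mean \<alpha>(1) by (intro diff_right_mono mult_left_mono)
    also have "\<dots> < 0"
      using \<alpha>(2) p by (simp add: field_simps)
    finally show "(\<integral>b. f b \<partial>U) < 0" .
  qed (rule renew_meas inv ind | assumption)+
  then have "AE b in S. surv b \<longrightarrow> (\<exists>C. \<forall>n. (\<Sum>i<n. f ((renew t ^^ i) b)) \<le> C)"
    unfolding U_def by (subst (asm) AE_uniform_measure) (use em in \<open>auto simp: P.emeasure_eq_measure\<close>)
  with AE_hereditary[OF p, of t] show ?thesis
  proof eventually_elim
    case (elim b)
    show ?case
    proof
      assume b: "surv b"
      then obtain C where "\<And>n. (\<Sum>i<n. f ((renew t ^^ i) b)) \<le> C"
        using elim by auto
      then have "\<alpha> * real n - (C + 1) \<le> real (heavy_steps t n b)" for n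
        using heavy_steps_lower_bound[OF t elim(1) b \<alpha>(1), of C n] by (simp add: f_def)
      then show "\<exists>C. \<forall>n. \<alpha> * real n - C \<le> real (heavy_steps t n b)" by blast
    qed
  qed
qed

text \<open>The critical slope itself is excluded in \<open>AE_heavy_steps\<close>. The factors
  \<open>j / Suc j\<close> approach it through a countable sequence, so one null set serves for all
  of them; the constant \<open>C\<close> may depend on \<open>j\<close>. A critical slope of 0 has
  no room below it and is treated separately.\<close>

lemma AE_spine:
  assumes p: "0 < surv_prob" and t: "1 \<le> t"
  shows "AE b in S. surv b \<longrightarrow>
    (\<forall>n. 1 \<le> b n (spine t n b, spine t (Suc n) b)) \<and>
    (\<forall>n. t ^ heavy_steps t n b \<le> (\<Prod>i<n. b i (spine t i b, spine t (Suc i) b))) \<and>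
    (\<forall>j::nat. \<exists>C. \<forall>n. surv_prob * measure S {b. heavy t b} * (real j / real (Suc j)) * real n - C
      \<le> real (heavy_steps t n b))"
proof -
  let ?c = "surv_prob * measure S {b. heavy t b}"
  have "AE b in S. surv b \<longrightarrow> (\<exists>C. \<forall>n. ?c * (real j / real (Suc j)) * real n - C \<le> real (heavy_steps t n b))" for j
  proof (cases "?c = 0")
    case True
    have "surv_prob * measure S {b. heavy t b} * (real j / real (Suc j)) * real n - 0 \<le> real (heavy_steps t n b)" for n b
      unfolding True by simp
    then show ?thesis by blast
  next
    case False
    then have "0 < ?c" by (simp add: less_le measure_nonneg)
    then have "?c * (real j / real (Suc j)) < ?c * 1"
      by (intro mult_strict_left_mono) auto
    then show ?thesis
      by (intro AE_heavy_steps[OF p t]) auto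
  qed
  then have "AE b in S. \<forall>j. surv b \<longrightarrow> (\<exists>C. \<forall>n. ?c * (real j / real (Suc j)) * real n - C \<le> real (heavy_steps t n b))"
    unfolding AE_all_countable by blast
  with AE_hereditary[OF p, of t] show ?thesis
    by eventually_elim (use spine_open heavy_steps_weight in blast)
qed

end

section \<open>Open paths, matrix products and blocks\<close>

lemma alive_iff_path:
  "alive k b \<longleftrightarrow> (\<exists>\<gamma>. \<gamma> 0 = 0 \<and> (\<forall>i<k. 1 \<le> b i (\<gamma> i, \<gamma> (Suc i))))"
proof (induction k arbitrary: b)
  case 0
  show ?case by (auto intro: exI[of _ "\<lambda>_. 0"])
next
  case (Suc k)
  show ?case
  proof
    assume "alive (Suc k) b"
    then obtain y \<gamma> where y: "1 \<le> b 0 (0, y)" and \<gamma>: "\<gamma> 0 = 0"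
      "\<forall>i<k. 1 \<le> seen_from (Suc 0) y b i (\<gamma> i, \<gamma> (Suc i))"
      unfolding alive.simps Suc.IH by blast
    have "1 \<le> b i (case i of 0 \<Rightarrow> 0 | Suc j \<Rightarrow> \<gamma> j + y, \<gamma> i + y)" if "i < Suc k" for i
      using y \<gamma> that by (cases i) (auto simp: seen_from_apply)
    then show "\<exists>\<gamma>. \<gamma> 0 = 0 \<and> (\<forall>i<Suc k. 1 \<le> b i (\<gamma> i, \<gamma> (Suc i)))"
      by (intro exI[of _ "\<lambda>i. case i of 0 \<Rightarrow> 0 | Suc j \<Rightarrow> \<gamma> j + y"]) simp
  next
    assume "\<exists>\<gamma>. \<gamma> 0 = 0 \<and> (\<forall>i<Suc k. 1 \<le> b i (\<gamma> i, \<gamma> (Suc i)))"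
    then obtain \<gamma> where \<gamma>: "\<gamma> 0 = 0" "\<forall>i<Suc k. 1 \<le> b i (\<gamma> i, \<gamma> (Suc i))" by blast
    have "alive k (seen_from (Suc 0) (\<gamma> (Suc 0)) b)"
      unfolding Suc.IH using \<gamma>
      by (intro exI[of _ "\<lambda>i. \<gamma> (Suc i) - \<gamma> (Suc 0)"]) (auto simp: seen_from_apply)
    moreover have "1 \<le> b 0 (0, \<gamma> (Suc 0))" using \<gamma> by force
    ultimately show "alive (Suc k) b" by auto
  qed
qed

definition zero_or_ge_1 :: "(nat \<Rightarrow> ('d::finite) lmatrix) \<Rightarrow> bool" where
  "zero_or_ge_1 b \<longleftrightarrow> (\<forall>n\<ge>1. \<forall>p. b n p = 0 \<or> 1 \<le> b n p)"

lemma mat_prod_neq_0_path: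
  assumes "zero_or_ge_1 b" "mat_prod b m (x, z) \<noteq> 0"
  shows "\<exists>\<gamma>. \<gamma> 0 = x \<and> \<gamma> m = z \<and> (\<forall>i<m. 1 \<le> b (Suc i) (\<gamma> i, \<gamma> (Suc i)))"
  using assms(2)
proof (induction m arbitrary: z)
  case 0
  then show ?case by (intro exI[of _ "\<lambda>_. x"]) (simp split: if_splits)
next
  case (Suc m)
  have "\<exists>y. mat_prod b m (x, y) * b (Suc m) (y, z) \<noteq> 0"
  proof (rule ccontr)
    assume "\<nexists>y. mat_prod b m (x, y) * b (Suc m) (y, z) \<noteq> 0"
    then have "(\<lambda>y. mat_prod b m (x, y) * b (Suc m) (y, z)) = (\<lambda>_. 0)" by blast
    then have "mat_prod b (Suc m) (x, z) = 0"
      by (simp add: mat_mult_def del: mult_eq_0_iff)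
    with Suc.prems show False by blast
  qed
  then obtain y where y: "mat_prod b m (x, y) \<noteq> 0" "b (Suc m) (y, z) \<noteq> 0" by auto
  from Suc.IH[OF y(1)] obtain \<gamma> where \<gamma>: "\<gamma> 0 = x" "\<gamma> m = y" "\<forall>i<m. 1 \<le> b (Suc i) (\<gamma> i, \<gamma> (Suc i))"
    by blast
  have "1 \<le> b (Suc m) (y, z)"
    using assms(1) y(2) unfolding zero_or_ge_1_def by (metis le_add1 plus_1_eq_Suc)
  with \<gamma> show ?case
    by (intro exI[of _ "\<gamma>(Suc m := z)"]) (auto simp: less_Suc_eq)
qed

lemma mat_prod_term_le: "mat_prod b m (x, y) * b (Suc m) (y, z) \<le> mat_prod b (Suc m) (x, z)"
  by (simp add: mat_mult_def) (rule nn_integral_ge_point, simp)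

lemma mat_prod_path_ge_1:
  "(\<And>i. i < m \<Longrightarrow> 1 \<le> b (Suc i) (\<gamma> i, \<gamma> (Suc i))) \<Longrightarrow> 1 \<le> mat_prod b m (\<gamma> 0, \<gamma> m)"
proof (induction m)
  case (Suc m)
  have "1 * 1 \<le> mat_prod b m (\<gamma> 0, \<gamma> m) * b (Suc m) (\<gamma> m, \<gamma> (Suc m))"
    using Suc by (intro mult_mono) auto
  also have "\<dots> \<le> mat_prod b (Suc m) (\<gamma> 0, \<gamma> (Suc m))"
    by (rule mat_prod_term_le)
  finally show ?case by simp
qed simp

text \<open>A nonzero entry of the product requires an open path between the two sites, and any open
  path already contributes at least 1.\<close>

lemma mat_prod_zero_or_ge_1:
  assumes "zero_or_ge_1 b" shows "mat_prod b m p = 0 \<or> 1 \<le> mat_prod b m p"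
proof (cases p)
  case (Pair x z)
  then show ?thesis
    using mat_prod_neq_0_path[OF assms, of m x z] mat_prod_path_ge_1[of m b] by metis
qed

lemma mass_eq_mat_prod: "mass b n x = mat_prod b n (0, x)"
  by (induction n arbitrary: x) (auto simp: mat_mult_def)

lemma mass_step: "mass b n x * b (Suc n) (x, y) \<le> mass b (Suc n) y"
  unfolding mass_eq_mat_prod by (rule mat_prod_term_le)

lemma mass_mat_prod: "mass b n x * mat_prod (\<lambda>j. b (n + j)) m (x, y) \<le> mass b (n + m) y"
proof (induction m arbitrary: y)
  case (Suc m)
  have "mass b n x * mat_prod (\<lambda>j. b (n + j)) (Suc m) (x, y) =
     (\<integral>\<^sup>+ z. mass b n x * mat_prod (\<lambda>j. b (n + j)) m (x, z) * b (Suc (n + m)) (z, y) \<partial>count_space UNIV)"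
    by (simp add: mat_mult_def nn_integral_cmult[symmetric] mult.assoc)
  also have "\<dots> \<le> (\<integral>\<^sup>+ z. mass b (n + m) z * b (Suc (n + m)) (z, y) \<partial>count_space UNIV)"
    by (intro nn_integral_mono mult_right_mono Suc.IH) auto
  finally show ?case by simp
qed auto

lemma total_mass_ge_1_iff_alive:
  assumes "zero_or_ge_1 b"
  shows "1 \<le> total_mass b n \<longleftrightarrow> alive n (\<lambda>k. b (Suc k))"
    and "total_mass b n = 0 \<longleftrightarrow> \<not> alive n (\<lambda>k. b (Suc k))"
proof -
  have 1: "alive n (\<lambda>k. b (Suc k))" if "total_mass b n \<noteq> 0"
  proof -
    have "\<exists>x. mass b n x \<noteq> 0"
    proof (rule ccontr)
      assume "\<nexists>x. mass b n x \<noteq> 0"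
      then have "total_mass b n = 0" by (simp add: total_mass_def)
      with that show False by simp
    qed
    then obtain x where "mat_prod b n (0, x) \<noteq> 0" by (auto simp: mass_eq_mat_prod)
    from mat_prod_neq_0_path[OF assms this] show ?thesis
      unfolding alive_iff_path by blast
  qed
  have 2: "1 \<le> total_mass b n" if "alive n (\<lambda>k. b (Suc k))"
  proof -
    obtain \<gamma> where "\<gamma> 0 = 0" "\<forall>i<n. 1 \<le> b (Suc i) (\<gamma> i, \<gamma> (Suc i))"
      using \<open>alive n _\<close> unfolding alive_iff_path by blast
    then have "1 \<le> mass b n (\<gamma> n)"
      using mat_prod_path_ge_1[of n b \<gamma>] by (simp add: mass_eq_mat_prod)
    also have "\<dots> \<le> total_mass b n"
      unfolding total_mass_def by (rule nn_integral_ge_point) simp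
    finally show ?thesis .
  qed
  show "1 \<le> total_mass b n \<longleftrightarrow> alive n (\<lambda>k. b (Suc k))"
    "total_mass b n = 0 \<longleftrightarrow> \<not> alive n (\<lambda>k. b (Suc k))"
    using 1 2 by force+
qed

lemma survives_iff_surv: "zero_or_ge_1 b \<Longrightarrow> survives b \<longleftrightarrow> surv (\<lambda>k. b (Suc k))"
  by (simp add: survives_def surv_def total_mass_ge_1_iff_alive)

text \<open>Blocks are numbered from 0, as \<open>alive\<close> and \<open>surv\<close> expect,
  while the original matrices are numbered from 1: block \<open>k\<close> is the product of
  \<open>b (k * m + 1)\<close> up to \<open>b (k * m + m)\<close>.\<close>

definition block :: "nat \<Rightarrow> (nat \<Rightarrow> ('d::finite) lmatrix) \<Rightarrow> nat \<Rightarrow> 'd lmatrix" where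
  "block m b k = mat_prod (\<lambda>j. b (k * m + j)) m"

lemma zero_or_ge_1_shift: "zero_or_ge_1 b \<Longrightarrow> zero_or_ge_1 (\<lambda>j. b (k + j))"
  by (simp add: zero_or_ge_1_def)

lemma block_path:
  assumes "zero_or_ge_1 b" "1 \<le> block m b k (x, y)"
  shows "\<exists>\<gamma>. \<gamma> 0 = x \<and> \<gamma> m = y \<and> (\<forall>i<m. 1 \<le> b (Suc (k * m + i)) (\<gamma> i, \<gamma> (Suc i)))"
proof -
  have "mat_prod (\<lambda>j. b (k * m + j)) m (x, y) \<noteq> 0"
    using assms(2) by (metis block_def not_one_le_zero)
  from mat_prod_neq_0_path[OF zero_or_ge_1_shift[OF assms(1)] this] show ?thesis by simp
qed

text \<open>Concatenation of pieces of length \<open>m\<close>, the \<open>k\<close>-th being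
  \<open>g k\<close>. Only a step with \<open>n mod m = m - 1\<close> leaves its piece, and there
  the endpoint must match the next starting point.\<close>

lemma glue_edge:
  assumes m: "0 < m"
    and "g (n div m) m = g (Suc (n div m)) 0"
    and "\<And>i. i < m \<Longrightarrow> 1 \<le> b (Suc ((n div m) * m + i)) (g (n div m) i, g (n div m) (Suc i))"
  shows "1 \<le> b (Suc n) (g (n div m) (n mod m), g (Suc n div m) (Suc n mod m))"
proof -
  have "n mod m < m" using m by simp
  from assms(3)[OF this]
  have *: "1 \<le> b (Suc n) (g (n div m) (n mod m), g (n div m) (Suc (n mod m)))" by simp
  show ?thesis
  proof (cases "Suc (n mod m) = m")
    case True
    then have "Suc n mod m = 0" "Suc n div m = Suc (n div m)"
      by (simp_all add: mod_Suc div_Suc)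
    then show ?thesis using * assms(2) True by simp
  next
    case False
    then have "Suc n mod m = Suc (n mod m)" "Suc n div m = n div m"
      by (simp_all add: mod_Suc div_Suc)
    then show ?thesis using * by simp
  qed
qed

lemma surv_block_iff:
  assumes b: "zero_or_ge_1 b" and m: "0 < m"
  shows "surv (block m b) \<longleftrightarrow> surv (\<lambda>k. b (Suc k))"
proof -
  have "alive k (block m b) \<longleftrightarrow> alive (k * m) (\<lambda>n. b (Suc n))" for k
  proof
    assume "alive k (block m b)"
    then obtain X where X: "X 0 = 0" "\<forall>i<k. 1 \<le> block m b i (X i, X (Suc i))"
      unfolding alive_iff_path by blast
    have "\<forall>i. \<exists>\<gamma>. \<gamma> 0 = X i \<and> (i < k \<longrightarrow> \<gamma> m = X (Suc i) \<and>
        (\<forall>j<m. 1 \<le> b (Suc (i * m + j)) (\<gamma> j, \<gamma> (Suc j))))"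
    proof
      fix i
      show "\<exists>\<gamma>. \<gamma> 0 = X i \<and> (i < k \<longrightarrow> \<gamma> m = X (Suc i) \<and>
        (\<forall>j<m. 1 \<le> b (Suc (i * m + j)) (\<gamma> j, \<gamma> (Suc j))))"
        using block_path[OF b, of m i "X i" "X (Suc i)"] X by (cases "i < k") auto
    qed
    then obtain g where g0: "\<And>i. g i 0 = X i" and g: "\<And>i. i < k \<Longrightarrow> g i m = X (Suc i)"
      "\<And>i j. i < k \<Longrightarrow> j < m \<Longrightarrow> 1 \<le> b (Suc (i * m + j)) (g i j, g i (Suc j))"
      by metis
    have "1 \<le> b (Suc n) (g (n div m) (n mod m), g (Suc n div m) (Suc n mod m))" if "n < k * m" for n
    proof -
      have "n div m < k" using that m by (simp add: div_less_iff_less_mult)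
      then show ?thesis using g0 g by (intro glue_edge[where g = g and b = b and n = n, OF m]) auto
    qed
    then show "alive (k * m) (\<lambda>n. b (Suc n))"
      unfolding alive_iff_path using g0 X
      by (intro exI[of _ "\<lambda>n. g (n div m) (n mod m)"]) simp
  next
    assume "alive (k * m) (\<lambda>n. b (Suc n))"
    then obtain \<gamma> where \<gamma>: "\<gamma> 0 = 0" "\<forall>i<k * m. 1 \<le> b (Suc i) (\<gamma> i, \<gamma> (Suc i))"
      unfolding alive_iff_path by blast
    have "1 \<le> block m b i (\<gamma> (i * m), \<gamma> (Suc i * m))" if "i < k" for i
    proof -
      have "Suc i * m \<le> k * m" using that by (intro mult_le_mono1) simp
      then have "1 \<le> mat_prod (\<lambda>j. b (i * m + j)) m (\<gamma> (i * m + 0), \<gamma> (i * m + m))"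
        using \<gamma>(2) mat_prod_path_ge_1[of m "\<lambda>j. b (i * m + j)" "\<lambda>j. \<gamma> (i * m + j)"]
        by (simp add: ac_simps)
      then show ?thesis by (simp add: block_def ac_simps)
    qed
    then show "alive k (block m b)"
      unfolding alive_iff_path using \<gamma>(1) by (intro exI[of _ "\<lambda>i. \<gamma> (i * m)"]) simp
  qed
  moreover have "k \<le> k * m" for k using m by simp
  ultimately show ?thesis
    unfolding surv_def using alive_mono by metis
qed

lemma mass_block_prod: "(\<Prod>i<k. block m b i (X i, X (Suc i))) * mass b 0 (X 0) \<le> mass b (k * m) (X k)"
proof (induction k)
  case (Suc k)
  have "(\<Prod>i<Suc k. block m b i (X i, X (Suc i))) * mass b 0 (X 0)
     = ((\<Prod>i<k. block m b i (X i, X (Suc i))) * mass b 0 (X 0)) * block m b k (X k, X (Suc k))"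
    by (simp add: ac_simps)
  also have "\<dots> \<le> mass b (k * m) (X k) * block m b k (X k, X (Suc k))"
    by (intro mult_right_mono Suc.IH) simp
  also have "\<dots> \<le> mass b (k * m + m) (X (Suc k))"
    unfolding block_def by (rule mass_mat_prod)
  finally show ?case by (simp add: ac_simps)
qed simp

lemma mass_open_path_mono:
  assumes "open_path b \<gamma>" "i \<le> n"
  shows "mass b i (\<gamma> i) \<le> mass b n (\<gamma> n)"
  using assms(2)
proof (induction n rule: dec_induct)
  case (step n)
  have "mass b n (\<gamma> n) * 1 \<le> mass b n (\<gamma> n) * b (Suc n) (\<gamma> n, \<gamma> (Suc n))"
    using assms(1) by (intro mult_left_mono) (auto simp: open_path_def)
  with step.IH mass_step[of b n "\<gamma> n" "\<gamma> (Suc n)"] show ?case by simp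
qed simp

section \<open>From step counts to logarithmic growth rates\<close>

lemma log_ennreal_mono: "a \<le> b \<Longrightarrow> log_ennreal a \<le> log_ennreal b"
proof (cases "a = 0 \<or> b = \<infinity>")
  case False
  assume "a \<le> b"
  with False have "0 < enn2real a" "enn2real a \<le> enn2real b" "b \<noteq> 0" "a \<noteq> \<infinity>"
    by (auto simp: enn2real_positive_iff top.not_eq_extremum zero_less_iff_neq_zero intro!: enn2real_mono intro: le_less_trans)
  with False show ?thesis by (auto simp: log_ennreal_def)
qed (auto simp: log_ennreal_def)

lemma log_ennreal_ennreal: "0 < x \<Longrightarrow> log_ennreal (ennreal x) = ereal (ln x)"
  by (simp add: log_ennreal_def)

text \<open>For fixed \<open>j\<close> the additive constant \<open>C\<close> and the rounding in
  \<open>n div m\<close> vanish after division by \<open>n\<close>. The slope factor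
  \<open>j / Suc j\<close> is sent to 1 only after the liminf has been bounded, since
  \<open>C\<close> depends on \<open>j\<close>.\<close>

lemma liminf_log_growth:
  fixes u :: "nat \<Rightarrow> ennreal" and h :: "nat \<Rightarrow> nat"
  assumes \<delta>: "0 < \<delta>" and m: "0 < m" and c: "0 \<le> c"
    and u: "\<And>n. ennreal (1 + \<delta>) ^ h (n div m) \<le> u n"
    and h: "\<And>j. \<exists>C. \<forall>n. c * (real j / real (Suc j)) * real n - C \<le> real (h n)"
  shows "ereal (1 / real m * c * ln (1 + \<delta>)) \<le> liminf (\<lambda>n. log_ennreal (u n) / ereal (real n))"
proof -
  let ?l = "liminf (\<lambda>n. log_ennreal (u n) / ereal (real n))"
  have step: "ereal (1 / real m * (c * (real j / real (Suc j))) * ln (1 + \<delta>)) \<le> ?l" for j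
  proof -
    define \<alpha> where "\<alpha> = c * (real j / real (Suc j))"
    have \<alpha>: "0 \<le> \<alpha>" using c by (simp add: \<alpha>_def)
    obtain C where C: "\<And>n. \<alpha> * real n - C \<le> real (h n)"
      using h[of j] by (auto simp: \<alpha>_def)
    \<comment> \<open>Comes from \<open>n div m \<ge> n / m - 1\<close>.\<close>
    let ?v = "\<lambda>n. (\<alpha> * (real n / real m - 1) - C) * ln (1 + \<delta>) / real n"
    have "?v \<longlonglongrightarrow> 1 / real m * \<alpha> * ln (1 + \<delta>)"
    proof (rule Lim_transform_eventually)
      have "(\<lambda>n. (\<alpha> / real m - (\<alpha> + C) * inverse (real n)) * ln (1 + \<delta>))
          \<longlonglongrightarrow> (\<alpha> / real m - (\<alpha> + C) * 0) * ln (1 + \<delta>)"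
        by (intro tendsto_intros LIMSEQ_inverse_real_of_nat[THEN LIMSEQ_imp_Suc, simplified] lim_inverse_n)
      then show "(\<lambda>n. (\<alpha> / real m - (\<alpha> + C) * inverse (real n)) * ln (1 + \<delta>)) \<longlonglongrightarrow> 1 / real m * \<alpha> * ln (1 + \<delta>)"
        by simp
      show "eventually (\<lambda>n. (\<alpha> / real m - (\<alpha> + C) * inverse (real n)) * ln (1 + \<delta>) = ?v n) sequentially"
        by (rule eventually_mono[OF eventually_gt_at_top[of 0]]) (use m in \<open>simp add: field_simps\<close>)
    qed
    then have "(\<lambda>n. ereal (?v n)) \<longlonglongrightarrow> ereal (1 / real m * \<alpha> * ln (1 + \<delta>))"
      by simp
    then have "liminf (\<lambda>n. ereal (?v n)) = ereal (1 / real m * \<alpha> * ln (1 + \<delta>))"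
      by (intro lim_imp_Liminf) auto
    moreover have "liminf (\<lambda>n. ereal (?v n)) \<le> ?l"
    proof (rule Liminf_mono)
      show "eventually (\<lambda>n. ereal (?v n) \<le> log_ennreal (u n) / ereal (real n)) sequentially"
        using eventually_gt_at_top[of 0]
      proof eventually_elim
        case (elim n)
        let ?k = "h (n div m)"
        have "real n \<le> real m * (real (n div m) + 1)"
        proof -
          have "n \<le> m * (n div m) + m"
            using mult_div_mod_eq[of m n] mod_less_divisor[OF m, of n] by linarith
          then have "real n \<le> real (m * (n div m) + m)" by (simp only: of_nat_le_iff)
          then show ?thesis by (simp add: algebra_simps)
        qed
        then have "real n / real m - 1 \<le> real (n div m)"
          using m by (simp add: field_simps)
        then have "\<alpha> * (real n / real m - 1) - C \<le> \<alpha> * real (n div m) - C"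
          using \<alpha> by (intro diff_right_mono mult_left_mono)
        also have "\<dots> \<le> real ?k" by (rule C)
        finally have "(\<alpha> * (real n / real m - 1) - C) * ln (1 + \<delta>) \<le> real ?k * ln (1 + \<delta>)"
          using \<delta> by (intro mult_right_mono) auto
        then have "?v n \<le> real ?k * ln (1 + \<delta>) / real n"
          by (intro divide_right_mono) auto
        then have "ereal (?v n) \<le> ereal (real ?k * ln (1 + \<delta>)) / ereal (real n)"
          using elim by simp
        also have "ereal (real ?k * ln (1 + \<delta>)) = log_ennreal (ennreal (1 + \<delta>) ^ ?k)"
          using \<delta> by (simp add: ennreal_power log_ennreal_ennreal ln_realpow del: ennreal_plus)
        also have "\<dots> / ereal (real n) \<le> log_ennreal (u n) / ereal (real n)"
          using elim by (intro ereal_divide_right_mono log_ennreal_mono u) auto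
        finally show ?case .
      qed
    qed
    ultimately show ?thesis by (simp add: \<alpha>_def)
  qed
  have "(\<lambda>j. 1 / real m * (c * (real j / real (Suc j))) * ln (1 + \<delta>))
      \<longlonglongrightarrow> 1 / real m * (c * 1) * ln (1 + \<delta>)"
    by (intro tendsto_intros LIMSEQ_n_over_Suc_n)
  then have "(\<lambda>j. ereal (1 / real m * (c * (real j / real (Suc j))) * ln (1 + \<delta>)))
      \<longlonglongrightarrow> ereal (1 / real m * c * ln (1 + \<delta>))"
    by simp
  then show ?thesis
    by (rule LIMSEQ_le_const2) (use step in blast)
qed

section \<open>Products of independent matrices\<close>

lemma borel_measurable_nn_integral_count_space:
  fixes f :: "'a \<Rightarrow> 'b::countable \<Rightarrow> ennreal"
  assumes "\<And>y. (\<lambda>x. f x y) \<in> borel_measurable N"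
  shows "(\<lambda>x. \<integral>\<^sup>+ y. f x y \<partial>count_space UNIV) \<in> borel_measurable N"
proof -
  interpret sigma_finite_measure "count_space UNIV :: 'b measure"
    by (rule sigma_finite_measure_count_space)
  have "(\<lambda>p. f (fst p) (snd p)) \<in> borel_measurable (N \<Otimes>\<^sub>M count_space UNIV)"
    by (rule measurable_compose_countable[where f="\<lambda>y p. f (fst p) y" and g=snd])
       (auto intro: measurable_compose[OF measurable_fst assms])
  then show ?thesis
    by (intro borel_measurable_nn_integral) (simp add: case_prod_beta')
qed

lemma mat_prod_measurable:
  assumes "\<And>j. 1 \<le> j \<Longrightarrow> j \<le> m \<Longrightarrow> (\<lambda>x. f x j) \<in> measurable N matrix_space"
  shows "(\<lambda>x. mat_prod (f x) m) \<in> measurable N matrix_space"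
  using assms
proof (induction m)
  case (Suc m)
  have [measurable]: "(\<lambda>x. mat_prod (f x) m) \<in> measurable N matrix_space"
    "(\<lambda>x. f x (Suc m)) \<in> measurable N matrix_space"
    using Suc by auto
  show ?case
  proof (rule matrix_measurableI)
    fix p :: "'b lattice \<times> 'b lattice"
    show "(\<lambda>x. mat_prod (f x) (Suc m) p) \<in> borel_measurable N"
      by (cases p) (auto simp: mat_mult_def intro!: borel_measurable_nn_integral_count_space)
  qed
qed (simp add: matrix_measurableI)

lemma mat_prod_cong: "(\<And>j. 1 \<le> j \<Longrightarrow> j \<le> m \<Longrightarrow> b j = b' j) \<Longrightarrow> mat_prod b m = mat_prod b' m"
  by (induction m) auto

lemma mass_cong: "(\<And>j. 1 \<le> j \<Longrightarrow> j \<le> n \<Longrightarrow> b j = b' j) \<Longrightarrow> mass b n = mass b' n"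
  by (rule ext) (simp add: mass_eq_mat_prod mat_prod_cong[of n b b'])

lemma survives_cong: "(\<And>j. 1 \<le> j \<Longrightarrow> b j = b' j) \<Longrightarrow> survives b = survives b'"
  unfolding survives_def total_mass_def using mass_cong[of _ b b'] by simp

lemma translate_mat_mult: "translate z (mat_mult a b) = mat_mult (translate z a) (translate z b)"
proof (rule ext, clarify)
  fix u v
  have "(\<integral>\<^sup>+ y. a (u + z, y + z) * b (y + z, v + z) \<partial>count_space UNIV)
      = (\<integral>\<^sup>+ y. a (u + z, y) * b (y, v + z) \<partial>count_space UNIV)"
    by (rule nn_integral_bij_count_space[where g="\<lambda>y. y + z"])
       (auto intro!: bij_betwI[where g="\<lambda>y. y - z"])
  then show "translate z (mat_mult a b) (u, v) = mat_mult (translate z a) (translate z b) (u, v)"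
    by (simp add: translate_def mat_mult_def)
qed

lemma translate_mat_prod: "translate z (mat_prod b m) = mat_prod (\<lambda>j. translate z (b j)) m"
proof (induction m)
  case 0
  show ?case by (auto simp: translate_def fun_eq_iff)
next
  case (Suc m)
  then show ?case by (simp add: translate_mat_mult)
qed

lemma survives_measurable:
  assumes "\<And>n. 1 \<le> n \<Longrightarrow> (\<lambda>x. f x n) \<in> measurable N matrix_space"
  shows "Measurable.pred N (\<lambda>x. survives (f x))"
proof -
  have "(\<lambda>x. mass (f x) n y) \<in> borel_measurable N" for n y
    unfolding mass_eq_mat_prod using mat_prod_measurable[of n f N] assms by measurable
  then have [measurable]: "(\<lambda>x. total_mass (f x) n) \<in> borel_measurable N" for n
    unfolding total_mass_def by (rule borel_measurable_nn_integral_count_space)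
  show ?thesis unfolding survives_def by measurable
qed

text \<open>Mediates between the index sets: the given matrices and the process in
  \<open>c_delta\<close> are indexed from 1, environments and blocks from 0.\<close>

lemma distr_PiM_reindexed:
  assumes law: "distr P (\<Pi>\<^sub>M k\<in>K. N) X = (\<Pi>\<^sub>M k\<in>K. L)"
    and X: "X \<in> measurable P (\<Pi>\<^sub>M k\<in>K. N)"
    and L: "prob_space L" "sets L = sets N" and f: "inj_on f I" "f \<in> I \<rightarrow> K"
  shows "distr P (\<Pi>\<^sub>M i\<in>I. N) (\<lambda>\<omega>. \<lambda>i\<in>I. X \<omega> (f i)) = (\<Pi>\<^sub>M i\<in>I. L)"
proof -
  let ?g = "\<lambda>b. \<lambda>i\<in>I. b (f i)"
  have sets: "sets (\<Pi>\<^sub>M i\<in>I. L) = sets (\<Pi>\<^sub>M i\<in>I. N)"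
    by (rule sets_PiM_cong) (simp_all add: L)
  have g: "?g \<in> measurable (\<Pi>\<^sub>M k\<in>K. N) (\<Pi>\<^sub>M i\<in>I. N)"
    using f by (intro measurable_restrict measurable_component_singleton) auto
  have "distr P (\<Pi>\<^sub>M i\<in>I. N) (\<lambda>\<omega>. \<lambda>i\<in>I. X \<omega> (f i)) = distr (\<Pi>\<^sub>M k\<in>K. L) (\<Pi>\<^sub>M i\<in>I. N) ?g"
    unfolding law[symmetric] by (simp add: distr_distr[OF g X] comp_def)
  also have "\<dots> = distr (\<Pi>\<^sub>M k\<in>K. L) (\<Pi>\<^sub>M i\<in>I. L) ?g"
    by (rule distr_cong) (simp_all add: sets)
  also have "\<dots> = (\<Pi>\<^sub>M i\<in>I. L)"
    using distr_PiM_reindex[of K "\<lambda>_. L" f I] L f by simp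
  finally show ?thesis .
qed

locale matrix_products = prob_space P for P :: "'w measure" +
  fixes Bs :: "nat \<Rightarrow> 'w \<Rightarrow> ('d::finite) lmatrix" and L :: "'d lmatrix measure"
  assumes indep: "indep_vars (\<lambda>_. matrix_space) Bs {1..}"
    and law: "\<And>n. 1 \<le> n \<Longrightarrow> distr P matrix_space (Bs n) = L"
    and inv: "\<And>z. distr L matrix_space (translate z) = L"
    and entries: "AE b in L. \<forall>p. b p = 0 \<or> (1 \<le> b p \<and> b p < \<infinity>)"
begin

lemma Bs_measurable [measurable]: "1 \<le> n \<Longrightarrow> Bs n \<in> measurable P matrix_space"
  using indep by (simp add: indep_vars_def)

lemma prob_space_L: "prob_space L"
  using prob_space_distr[of "Bs 1" matrix_space] law[of 1] by simp

lemma sets_L: "sets L = sets matrix_space"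
  using law[of 1] by (metis order_refl sets_distr)

sublocale L: iid_matrices L
proof -
  interpret L: prob_space L by (rule prob_space_L)
  show "iid_matrices L"
    by unfold_locales (use sets_L inv in auto)
qed

lemma AE_Bs:
  assumes "1 \<le> n" "AE b in L. A b"
  shows "AE \<omega> in P. A (Bs n \<omega>)"
proof (rule AE_distrD[of "Bs n" P matrix_space])
  show "AE b in distr P matrix_space (Bs n). A b"
    unfolding law[OF assms(1)] by (rule assms(2))
qed (rule Bs_measurable[OF assms(1)])

lemma AE_zero_or_ge_1: "AE \<omega> in P. zero_or_ge_1 (\<lambda>n. Bs n \<omega>)"
proof -
  have "AE \<omega> in P. 1 \<le> n \<longrightarrow> (\<forall>p. Bs n \<omega> p = 0 \<or> 1 \<le> Bs n \<omega> p)" for n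
  proof (cases "1 \<le> n")
    case True
    have "AE b in L. \<forall>p. b p = 0 \<or> 1 \<le> b p"
      using entries by eventually_elim blast
    from AE_Bs[OF True this] show ?thesis by eventually_elim blast
  qed auto
  then have "AE \<omega> in P. \<forall>n. 1 \<le> n \<longrightarrow> (\<forall>p. Bs n \<omega> p = 0 \<or> 1 \<le> Bs n \<omega> p)"
    unfolding AE_all_countable by blast
  then show ?thesis by (simp add: zero_or_ge_1_def)
qed

lemma shifted_law: "distr P env_space (\<lambda>\<omega> i. Bs (Suc (a + i)) \<omega>) = (\<Pi>\<^sub>M i\<in>UNIV. L)"
proof -
  let ?X = "\<lambda>\<omega>. \<lambda>n\<in>{1..}. Bs n \<omega>"
  have "distr P (\<Pi>\<^sub>M n\<in>{1..}. matrix_space) ?X = (\<Pi>\<^sub>M n\<in>{1..}. distr P matrix_space (Bs n))"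
    using indep by (subst (asm) indep_vars_iff_distr_eq_PiM') auto
  also have "\<dots> = (\<Pi>\<^sub>M n\<in>{1..}. L)"
    by (rule PiM_cong) (simp_all add: law)
  finally have "distr P (\<Pi>\<^sub>M i\<in>UNIV. matrix_space) (\<lambda>\<omega>. \<lambda>i\<in>UNIV. ?X \<omega> (Suc (a + i))) = (\<Pi>\<^sub>M i\<in>UNIV. L)"
    by (rule distr_PiM_reindexed)
       (auto simp: prob_space_L sets_L inj_on_def intro!: measurable_restrict)
  then show ?thesis
    by (simp add: env_space_def restrict_UNIV)
qed

text \<open>The shift \<open>j - 1\<close> adapts an environment indexed from 0 to
  \<open>mat_prod\<close>, which reads the indices 1 to \<open>m\<close>.\<close>

definition first_product :: "nat \<Rightarrow> (nat \<Rightarrow> 'd lmatrix) \<Rightarrow> 'd lmatrix" where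
  "first_product m b = mat_prod (\<lambda>j. b (j - 1)) m"

lemma first_product_measurable [measurable]: "first_product m \<in> measurable env_space matrix_space"
  unfolding first_product_def by (rule mat_prod_measurable) measurable

lemma block_eq_first_product: "block m (\<lambda>n. Bs n \<omega>) k = first_product m (\<lambda>i. Bs (Suc (k * m + i)) \<omega>)"
  unfolding block_def first_product_def by (rule mat_prod_cong) auto

lemma block_law: "distr P matrix_space (\<lambda>\<omega>. block m (\<lambda>n. Bs n \<omega>) k) = distr (\<Pi>\<^sub>M i\<in>UNIV. L) matrix_space (first_product m)"
proof -
  have "(\<lambda>\<omega> i. Bs (Suc (k * m + i)) \<omega>) \<in> measurable P env_space"
    by (rule env_measurableI) measurable
  then have "distr (distr P env_space (\<lambda>\<omega> i. Bs (Suc (k * m + i)) \<omega>)) matrix_space (first_product m)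
    = distr P matrix_space (\<lambda>\<omega>. block m (\<lambda>n. Bs n \<omega>) k)"
    by (subst distr_distr) (simp_all add: comp_def block_eq_first_product)
  then show ?thesis by (simp add: shifted_law)
qed

lemma prod_law_eq: "prod_law P Bs m = distr (\<Pi>\<^sub>M i\<in>UNIV. L) matrix_space (first_product m)"
proof -
  have "block m (\<lambda>n. Bs n \<omega>) 0 = mat_prod (\<lambda>n. Bs n \<omega>) m" for \<omega>
    by (simp add: block_def)
  then show ?thesis using block_law[of m 0] by (simp add: prod_law_def)
qed

lemma block_measurable [measurable]: "(\<lambda>\<omega>. block m (\<lambda>n. Bs n \<omega>) k) \<in> measurable P matrix_space"
  unfolding block_def by (rule mat_prod_measurable) simp

lemma sets_prod_law [simp, measurable_cong]: "sets (prod_law P Bs m) = sets matrix_space"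
  by (simp add: prod_law_def)

lemma prob_space_prod_law: "prob_space (prod_law P Bs m)"
  unfolding prod_law_def by (rule prob_space_distr, rule mat_prod_measurable) simp

lemma prod_law_invariant: "distr (prod_law P Bs m) matrix_space (translate z) = prod_law P Bs m"
proof -
  have fm [measurable]: "first_product m \<in> measurable (\<Pi>\<^sub>M i\<in>UNIV. L) matrix_space"
    by (simp add: L.measurable_S)
  have sm [measurable]: "seen_from 0 z \<in> measurable (\<Pi>\<^sub>M i\<in>UNIV. L) (\<Pi>\<^sub>M i\<in>UNIV. L)"
    by measurable
  have "translate z (first_product m b) = first_product m (seen_from 0 z b)" for b
    by (simp add: first_product_def translate_mat_prod seen_from_def)
  then have "translate z \<circ> first_product m = first_product m \<circ> seen_from 0 z"
    by (simp add: fun_eq_iff)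
  then have "distr (prod_law P Bs m) matrix_space (translate z)
     = distr (distr (\<Pi>\<^sub>M i\<in>UNIV. L) (\<Pi>\<^sub>M i\<in>UNIV. L) (seen_from 0 z)) matrix_space (first_product m)"
    unfolding prod_law_eq by (subst (1 2) distr_distr) (auto simp: fm sm)
  then show ?thesis
    by (simp add: L.distr_translate prod_law_eq)
qed

lemma iid_prod_law: "iid_matrices (prod_law P Bs m)"
proof -
  interpret D: prob_space "prod_law P Bs m" by (rule prob_space_prod_law)
  show ?thesis
    by unfold_locales (use prod_law_invariant in auto)
qed

lemma indep_blocks:
  "indep_vars (\<lambda>_. matrix_space) (\<lambda>k \<omega>. block m (\<lambda>n. Bs n \<omega>) k) UNIV"
proof -
  let ?K = "\<lambda>k. {Suc (k * m)..k * m + m}"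
  have "disjoint_family_on ?K UNIV"
    unfolding disjoint_family_on_def
  proof (intro ballI impI)
    fix j k :: nat assume "j \<noteq> k"
    have "?K j \<inter> ?K k = {}" if "j < k" for j k
    proof -
      have "Suc j * m \<le> k * m" using that by (intro mult_le_mono1) simp
      then show ?thesis by auto
    qed
    then show "?K j \<inter> ?K k = {}"
      using \<open>j \<noteq> k\<close> by (cases j k rule: linorder_cases) auto
  qed
  then have "indep_vars (\<lambda>k. PiM (?K k) (\<lambda>_. matrix_space)) (\<lambda>k \<omega>. restrict (\<lambda>i. Bs i \<omega>) (?K k)) UNIV"
    by (intro indep_vars_restrict[OF indep]) auto
  then have "indep_vars (\<lambda>_. matrix_space) (\<lambda>k \<omega>. block m (restrict (\<lambda>i. Bs i \<omega>) (?K k)) k) UNIV"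
  proof (rule indep_vars_compose2)
    fix k
    show "(\<lambda>b. block m b k) \<in> measurable (PiM (?K k) (\<lambda>_. matrix_space)) matrix_space"
      unfolding block_def by (intro mat_prod_measurable measurable_component_singleton) auto
  qed
  moreover have "block m (restrict (\<lambda>i. Bs i \<omega>) (?K k)) k = block m (\<lambda>n. Bs n \<omega>) k" for k \<omega>
    unfolding block_def by (rule mat_prod_cong) auto
  ultimately show ?thesis by simp
qed

lemma blocks_law: "distr P env_space (\<lambda>\<omega>. block m (\<lambda>n. Bs n \<omega>)) = (\<Pi>\<^sub>M i\<in>UNIV. prod_law P Bs m)"
proof -
  have "distr P (\<Pi>\<^sub>M i\<in>UNIV. matrix_space) (\<lambda>\<omega>. \<lambda>k\<in>UNIV. block m (\<lambda>n. Bs n \<omega>) k)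
     = (\<Pi>\<^sub>M k\<in>UNIV. distr P matrix_space (\<lambda>\<omega>. block m (\<lambda>n. Bs n \<omega>) k))"
    by (rule indep_vars_iff_distr_eq_PiM'[THEN iffD1, OF _ _ indep_blocks]) auto
  then show ?thesis
    unfolding env_space_def block_law prod_law_eq restrict_UNIV .
qed

lemma blocks_law_from_1:
  "distr P (\<Pi>\<^sub>M k\<in>{1..}. matrix_space) (\<lambda>\<omega>. \<lambda>k\<in>{1..}. block m (\<lambda>n. Bs n \<omega>) (k - 1))
    = (\<Pi>\<^sub>M k\<in>{1..}. prod_law P Bs m)"
proof (rule distr_PiM_reindexed)
  show "distr P (\<Pi>\<^sub>M k\<in>UNIV. matrix_space) (\<lambda>\<omega>. block m (\<lambda>n. Bs n \<omega>)) = (\<Pi>\<^sub>M k\<in>UNIV. prod_law P Bs m)"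
    using blocks_law by (simp add: env_space_def)
  show "(\<lambda>\<omega>. block m (\<lambda>n. Bs n \<omega>)) \<in> measurable P (\<Pi>\<^sub>M k\<in>UNIV. matrix_space)"
    unfolding env_space_def[symmetric] by (rule env_measurableI) measurable
qed (auto simp: prob_space_prod_law inj_on_def)

definition surv_probability :: real where
  "surv_probability = prob {\<omega> \<in> space P. survives (\<lambda>n. Bs n \<omega>)}"

lemma surv_pred [measurable]: "Measurable.pred P (\<lambda>\<omega>. survives (\<lambda>n. Bs n \<omega>))"
  by (rule survives_measurable) simp

lemma AE_not_survives:
  assumes "surv_probability = 0"
  shows "AE \<omega> in P. \<not> survives (\<lambda>n. Bs n \<omega>)"
proof -
  have "{\<omega> \<in> space P. survives (\<lambda>n. Bs n \<omega>)} \<in> null_sets P"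
    using assms surv_pred unfolding surv_probability_def
    by (auto simp: null_sets_def emeasure_eq_measure pred_def)
  then have "AE \<omega> in P. \<omega> \<notin> {\<omega> \<in> space P. survives (\<lambda>n. Bs n \<omega>)}"
    by (rule AE_not_in)
  with AE_space show ?thesis
    by eventually_elim auto
qed

lemma AE_surv_block:
  assumes "1 \<le> m"
  shows "AE \<omega> in P. surv (block m (\<lambda>n. Bs n \<omega>)) \<longleftrightarrow> survives (\<lambda>n. Bs n \<omega>)"
  using AE_zero_or_ge_1
  by eventually_elim (use assms in \<open>simp add: survives_iff_surv surv_block_iff\<close>)

lemma measure_surv_prod_law:
  assumes "1 \<le> m"
  shows "measure (\<Pi>\<^sub>M i\<in>UNIV. prod_law P Bs m) {b. surv b} = surv_probability"
proof -
  have meas [measurable]: "(\<lambda>\<omega>. block m (\<lambda>n. Bs n \<omega>)) \<in> measurable P env_space"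
    by (rule env_measurableI) measurable
  have sets: "{b. surv b} \<in> sets env_space"
    using surv_measurable by (simp add: pred_def)
  have "measure (\<Pi>\<^sub>M i\<in>UNIV. prod_law P Bs m) {b. surv b}
     = prob ((\<lambda>\<omega>. block m (\<lambda>n. Bs n \<omega>)) -` {b. surv b} \<inter> space P)"
    unfolding blocks_law[symmetric] by (rule measure_distr[OF meas sets])
  also have "\<dots> = surv_probability"
    unfolding surv_probability_def
  proof (rule finite_measure_eq_AE)
    show "AE \<omega> in P. \<omega> \<in> (\<lambda>\<omega>. block m (\<lambda>n. Bs n \<omega>)) -` {b. surv b} \<inter> space P
        \<longleftrightarrow> \<omega> \<in> {\<omega> \<in> space P. survives (\<lambda>n. Bs n \<omega>)}"
      using AE_surv_block[OF assms] by eventually_elim auto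
  qed (use measurable_sets[OF meas sets] in auto)
  finally show ?thesis .
qed

text \<open>This is the first factor of \<open>c_delta\<close>. It is the same for all
  \<open>m\<close> because the process of blocks survives exactly when the original one
  does.\<close>

lemma measure_survives_prod_law:
  assumes "1 \<le> m"
  shows "measure (\<Pi>\<^sub>M n\<in>{1..}. prod_law P Bs m)
    {b \<in> space (\<Pi>\<^sub>M n\<in>{1..}. prod_law P Bs m). survives b} = surv_probability"
proof -
  let ?X = "\<lambda>\<omega>. \<lambda>k\<in>{1..}. block m (\<lambda>n. Bs n \<omega>) (k - 1)"
  let ?E = "(\<Pi>\<^sub>M k\<in>{1..}. matrix_space) :: (nat \<Rightarrow> 'd lmatrix) measure"
  have meas [measurable]: "?X \<in> measurable P ?E"
    by (rule measurable_restrict) measurable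
  have "Measurable.pred ?E survives"
    by (rule survives_measurable) (simp add: measurable_component_singleton)
  then have sets: "{b \<in> space ?E. survives b} \<in> sets ?E"
    by (simp add: pred_def)
  have "space (\<Pi>\<^sub>M n\<in>{1..}. prod_law P Bs m) = space ?E"
    by (intro sets_eq_imp_space_eq sets_PiM_cong) simp_all
  then have "measure (\<Pi>\<^sub>M n\<in>{1..}. prod_law P Bs m)
      {b \<in> space (\<Pi>\<^sub>M n\<in>{1..}. prod_law P Bs m). survives b}
    = prob (?X -` {b \<in> space ?E. survives b} \<inter> space P)"
    using measure_distr[OF meas sets] unfolding blocks_law_from_1 by (simp only:)
  also have "\<dots> = surv_probability"
    unfolding surv_probability_def
  proof (rule finite_measure_eq_AE)
    show "AE \<omega> in P. \<omega> \<in> ?X -` {b \<in> space ?E. survives b} \<inter> space P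
        \<longleftrightarrow> \<omega> \<in> {\<omega> \<in> space P. survives (\<lambda>n. Bs n \<omega>)}"
      using AE_surv_block[OF assms] AE_zero_or_ge_1
    proof eventually_elim
      case (elim \<omega>)
      have "zero_or_ge_1 (\<lambda>k. block m (\<lambda>n. Bs n \<omega>) (k - 1))"
        unfolding zero_or_ge_1_def block_def
        using mat_prod_zero_or_ge_1[OF zero_or_ge_1_shift[OF elim(2)]] by blast
      then have "survives (\<lambda>k. block m (\<lambda>n. Bs n \<omega>) (k - 1)) \<longleftrightarrow> surv (block m (\<lambda>n. Bs n \<omega>))"
        by (simp add: survives_iff_surv)
      moreover have "survives (?X \<omega>) \<longleftrightarrow> survives (\<lambda>k. block m (\<lambda>n. Bs n \<omega>) (k - 1))"
        by (rule survives_cong) simp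
      moreover have "\<omega> \<in> space P \<Longrightarrow> ?X \<omega> \<in> space ?E"
        using meas by (rule measurable_space)
      ultimately show ?case using elim by auto
    qed
  qed (use measurable_sets[OF meas sets] in auto)
  finally show ?thesis .
qed

lemma c_delta_prod_law:
  assumes "1 \<le> m"
  shows "c_delta \<delta> (prod_law P Bs m)
    = surv_probability * (SUP x. measure (prod_law P Bs m) {D. ennreal (1 + \<delta>) \<le> D (0, x)})"
proof -
  have "space (prod_law P Bs m) = UNIV"
    by (simp add: prod_law_def)
  then show ?thesis
    unfolding c_delta_def measure_survives_prod_law[OF assms] by simp
qed

end

section \<open>Growth along the leftmost infinite path\<close>

definition connecting_path :: "nat \<Rightarrow> (nat \<Rightarrow> ('d::finite) lmatrix) \<Rightarrow> 'd lattice \<Rightarrow> 'd lattice \<Rightarrow> 'd lattice list \<Rightarrow> bool" where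
  "connecting_path m b x y l \<longleftrightarrow> length l = Suc m \<and> l ! 0 = x \<and> l ! m = y \<and>
    (\<forall>i<m. 1 \<le> b (Suc i) (l ! i, l ! Suc i))"

text \<open>Lists of sites are countable, so taking the connecting path of least code is a
  measurable choice of the vertices inside a block.\<close>

definition connect :: "nat \<Rightarrow> (nat \<Rightarrow> ('d::finite) lmatrix) \<Rightarrow> 'd lattice \<Rightarrow> 'd lattice \<Rightarrow> 'd lattice list" where
  "connect m b x y = from_nat (LEAST i. connecting_path m b x y (from_nat i))"

lemma connecting_path_connect:
  assumes "zero_or_ge_1 b" "1 \<le> block m b k (x, y)"
  shows "connecting_path m (\<lambda>i. b (k * m + i)) x y (connect m (\<lambda>i. b (k * m + i)) x y)"
proof -
  obtain \<gamma> where "\<gamma> 0 = x" "\<gamma> m = y" "\<forall>i<m. 1 \<le> b (Suc (k * m + i)) (\<gamma> i, \<gamma> (Suc i))"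
    using block_path[OF assms] by blast
  then have "connecting_path m (\<lambda>i. b (k * m + i)) x y (from_nat (to_nat (map \<gamma> [0..<Suc m])))"
    by (auto simp: connecting_path_def nth_append simp del: upt_Suc)
  then show ?thesis
    unfolding connect_def by (rule LeastI)
qed

lemma connect_measurable:
  assumes "\<And>i. 1 \<le> i \<Longrightarrow> (\<lambda>\<omega>. f \<omega> i) \<in> measurable N matrix_space"
  shows "(\<lambda>\<omega>. connect m (f \<omega>) x y) \<in> measurable N (count_space UNIV)"
proof -
  have [measurable]: "(\<lambda>\<omega>. f \<omega> (Suc i)) \<in> measurable N matrix_space" for i
    by (rule assms) simp
  have "Measurable.pred N (\<lambda>\<omega>. connecting_path m (f \<omega>) x y l)" for l
    unfolding connecting_path_def by measurable
  then show ?thesis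
    unfolding connect_def by measurable
qed

context matrix_products
begin

lemma growth_along_path:
  assumes \<delta>: "0 < \<delta>" and m: "1 \<le> m"
  shows "\<exists>\<Gamma> :: nat \<Rightarrow> 'w \<Rightarrow> 'd lattice. (\<forall>n. \<Gamma> n \<in> measurable P (count_space UNIV)) \<and>
    (AE \<omega> in P. survives (\<lambda>n. Bs n \<omega>) \<longrightarrow> open_path (\<lambda>n. Bs n \<omega>) (\<lambda>n. \<Gamma> n \<omega>) \<and>
      ereal (1 / real m * c_delta \<delta> (prod_law P Bs m) * ln (1 + \<delta>))
        \<le> liminf (\<lambda>n. log_ennreal (mass (\<lambda>k. Bs k \<omega>) n (\<Gamma> n \<omega>)) / ereal (real n)))"
proof (cases "surv_probability = 0")
  case True
  from AE_not_survives[OF this] show ?thesis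
    by (intro exI[of _ "\<lambda>_ _. 0"]) auto
next
  case False
  then have p: "0 < surv_probability"
    using measure_nonneg[of P] by (simp add: surv_probability_def less_le)
  interpret D: iid_matrices "prod_law P Bs m" by (rule iid_prod_law)
  define t where "t = ennreal (1 + \<delta>)"
  have t: "1 \<le> t" using \<delta> by (simp add: t_def ennreal_le_iff flip: ennreal_1)
  \<comment> \<open>The probability of a heavy entry anywhere in row 0. It dominates the supremum
    over single entries in \<open>c_delta\<close>, so a rate stated with \<open>q\<close> is
    enough.\<close>
  define q where "q = measure D.S {b. heavy t b}"
  have D_surv: "D.surv_prob = surv_probability"
    by (rule measure_surv_prod_law[OF m])
  have "c_delta \<delta> (prod_law P Bs m) \<le> surv_probability * q"
    unfolding c_delta_prod_law[OF m]
  proof (intro mult_left_mono cSUP_least)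
    fix x :: "'d lattice"
    have meas: "(\<lambda>b. b 0) \<in> measurable D.S (prod_law P Bs m)" by measurable
    have sets: "{d. t \<le> d (0, x)} \<in> sets (prod_law P Bs m)"
    proof -
      have "Measurable.pred matrix_space (\<lambda>d. t \<le> d (0, x))" by measurable
      then show ?thesis by (simp add: pred_def)
    qed
    have "measure (prod_law P Bs m) {d. t \<le> d (0, x)}
      = measure (distr D.S (prod_law P Bs m) (\<lambda>b. b 0)) {d. t \<le> d (0, x)}"
      by (subst distr_PiM_component) (simp_all add: prob_space_prod_law)
    also have "\<dots> = measure D.S {b. t \<le> b 0 (0, x)}"
      using measure_distr[OF meas sets] by (simp add: vimage_def)
    also have "\<dots> \<le> q"
      unfolding q_def by (intro D.P.finite_measure_mono D.pred_sets_S heavy_measurable) (auto simp: heavy_def)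
    finally show "measure (prod_law P Bs m) {d. ennreal (1 + \<delta>) \<le> d (0, x)} \<le> q"
      by (simp add: t_def)
  qed (use p in auto)
  then have "1 / real m * c_delta \<delta> (prod_law P Bs m) * ln (1 + \<delta>)
      \<le> 1 / real m * (surv_probability * q) * ln (1 + \<delta>)"
    using \<delta> by (intro mult_right_mono mult_left_mono) auto
  note rate = this
  define b where "b \<omega> = (\<lambda>n. Bs n \<omega>)" for \<omega>
  define X where "X k \<omega> = spine t k (block m (b \<omega>))" for k \<omega>
  have b_meas: "(\<lambda>\<omega>. block m (b \<omega>)) \<in> measurable P env_space"
    unfolding b_def by (rule env_measurableI) measurable
  have X_meas: "X k \<in> measurable P (count_space UNIV)" for k
    unfolding X_def by (rule measurable_compose[OF b_meas spine_measurable])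
  \<comment> \<open>The spine visits block times only; each of its steps is realised by an open path
    of \<open>m\<close> original steps.\<close>
  define piece where "piece k \<omega> = connect m (\<lambda>i. b \<omega> (k * m + i)) (X k \<omega>) (X (Suc k) \<omega>)" for k \<omega>
  have piece_meas: "piece k \<in> measurable P (count_space UNIV)" for k
    unfolding piece_def
  proof (rule measurable_compose_countable[OF _ X_meas[of k]])
    fix x
    show "(\<lambda>\<omega>. connect m (\<lambda>i. b \<omega> (k * m + i)) x (X (Suc k) \<omega>)) \<in> measurable P (count_space UNIV)"
      by (rule measurable_compose_countable[OF connect_measurable X_meas[of "Suc k"]]) (simp add: b_def)
  qed
  define \<Gamma> where "\<Gamma> n \<omega> = piece (n div m) \<omega> ! (n mod m)" for n \<omega>
  have "\<Gamma> n \<in> measurable P (count_space UNIV)" for n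
    unfolding \<Gamma>_def by (rule measurable_compose[OF piece_meas]) simp
  moreover have "AE \<omega> in P. survives (b \<omega>) \<longrightarrow> open_path (b \<omega>) (\<lambda>n. \<Gamma> n \<omega>) \<and>
      ereal (1 / real m * c_delta \<delta> (prod_law P Bs m) * ln (1 + \<delta>))
        \<le> liminf (\<lambda>n. log_ennreal (mass (b \<omega>) n (\<Gamma> n \<omega>)) / ereal (real n))"
  proof -
    have "AE e in distr P env_space (\<lambda>\<omega>. block m (b \<omega>)). surv e \<longrightarrow>
      (\<forall>n. 1 \<le> e n (spine t n e, spine t (Suc n) e)) \<and>
      (\<forall>n. t ^ heavy_steps t n e \<le> (\<Prod>i<n. e i (spine t i e, spine t (Suc i) e))) \<and>
      (\<forall>j::nat. \<exists>C. \<forall>n. surv_probability * q * (real j / real (Suc j)) * real n - C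
        \<le> real (heavy_steps t n e))"
      using D.AE_spine[OF _ t] p unfolding b_def blocks_law D_surv q_def by simp
    from AE_distrD[OF b_meas this] AE_surv_block[OF m] AE_zero_or_ge_1
    show ?thesis
    proof eventually_elim
      case (elim \<omega>)
      show ?case
      proof
        assume "survives (b \<omega>)"
        then have surv: "surv (block m (b \<omega>))"
          using elim(2) by (simp add: b_def)
        have z: "zero_or_ge_1 (b \<omega>)" using elim(3) by (simp add: b_def)
        have edge: "1 \<le> block m (b \<omega>) k (X k \<omega>, X (Suc k) \<omega>)" for k
          using elim(1) surv unfolding X_def by blast
        have weight: "t ^ heavy_steps t k (block m (b \<omega>))
            \<le> (\<Prod>i<k. block m (b \<omega>) i (X i \<omega>, X (Suc i) \<omega>))" for k
          using elim(1) surv unfolding X_def by blast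
        have count: "\<exists>C. \<forall>n. surv_probability * q * (real j / real (Suc j)) * real n - C
            \<le> real (heavy_steps t n (block m (b \<omega>)))" for j
          using elim(1) surv by blast
        have piece: "connecting_path m (\<lambda>i. b \<omega> (k * m + i)) (X k \<omega>) (X (Suc k) \<omega>) (piece k \<omega>)" for k
          unfolding piece_def by (rule connecting_path_connect[OF z edge])
        have op: "open_path (b \<omega>) (\<lambda>n. \<Gamma> n \<omega>)"
          unfolding open_path_def
        proof
          fix n
          show "1 \<le> b \<omega> (Suc n) (\<Gamma> n \<omega>, \<Gamma> (Suc n) \<omega>)"
            unfolding \<Gamma>_def
          proof (rule glue_edge[where g = "\<lambda>k i. piece k \<omega> ! i" and b = "b \<omega>" and n = n])
            show "0 < m" using m by simp
            show "piece (n div m) \<omega> ! m = piece (Suc (n div m)) \<omega> ! 0"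
              using piece[of "n div m"] piece[of "Suc (n div m)"] by (simp add: connecting_path_def)
            show "1 \<le> b \<omega> (Suc (n div m * m + i)) (piece (n div m) \<omega> ! i, piece (n div m) \<omega> ! Suc i)"
              if "i < m" for i
              using piece[of "n div m"] that by (simp add: connecting_path_def)
          qed
        qed
        \<comment> \<open>At multiples of \<open>m\<close> the mass is bounded below by the product
          of block entries along the spine; between them it cannot decrease along an open
          path.\<close>
        have "t ^ heavy_steps t (n div m) (block m (b \<omega>)) \<le> mass (b \<omega>) n (\<Gamma> n \<omega>)" for n
        proof -
          let ?k = "n div m"
          have "t ^ heavy_steps t ?k (block m (b \<omega>)) \<le> mass (b \<omega>) (?k * m) (X ?k \<omega>)"
            using weight[of ?k] mass_block_prod[of m "b \<omega>" "\<lambda>i. X i \<omega>" ?k] by (simp add: X_def)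
          also have "X ?k \<omega> = \<Gamma> (?k * m) \<omega>"
            using piece[of ?k] m by (simp add: \<Gamma>_def connecting_path_def)
          also have "mass (b \<omega>) (?k * m) (\<Gamma> (?k * m) \<omega>) \<le> mass (b \<omega>) n (\<Gamma> n \<omega>)"
            using mass_open_path_mono[OF op, of "?k * m" n] by simp
          finally show ?thesis .
        qed
        then have "ereal (1 / real m * (surv_probability * q) * ln (1 + \<delta>))
            \<le> liminf (\<lambda>n. log_ennreal (mass (b \<omega>) n (\<Gamma> n \<omega>)) / ereal (real n))"
          using \<delta> m p count unfolding t_def
          by (intro liminf_log_growth[where h = "\<lambda>k. heavy_steps (ennreal (1 + \<delta>)) k (block m (b \<omega>))"])
             (auto simp: q_def)
        then show "open_path (b \<omega>) (\<lambda>n. \<Gamma> n \<omega>) \<and>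
          ereal (1 / real m * c_delta \<delta> (prod_law P Bs m) * ln (1 + \<delta>))
          \<le> liminf (\<lambda>n. log_ennreal (mass (b \<omega>) n (\<Gamma> n \<omega>)) / ereal (real n))"
          using op rate by (auto intro: order_trans[rotated])
      qed
    qed
  qed
  ultimately show ?thesis
    unfolding b_def by blast
qed

lemma growth_total_mass:
  assumes \<delta>: "0 < \<delta>" and m: "1 \<le> m"
  shows "AE \<omega> in P. survives (\<lambda>n. Bs n \<omega>) \<longrightarrow>
      ereal (1 / real m * c_delta \<delta> (prod_law P Bs m) * ln (1 + \<delta>))
        \<le> liminf (\<lambda>n. log_ennreal (total_mass (\<lambda>k. Bs k \<omega>) n) / ereal (real n))"
proof -
  obtain \<Gamma> :: "nat \<Rightarrow> 'w \<Rightarrow> 'd lattice" where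
    "AE \<omega> in P. survives (\<lambda>n. Bs n \<omega>) \<longrightarrow> open_path (\<lambda>n. Bs n \<omega>) (\<lambda>n. \<Gamma> n \<omega>) \<and>
      ereal (1 / real m * c_delta \<delta> (prod_law P Bs m) * ln (1 + \<delta>))
        \<le> liminf (\<lambda>n. log_ennreal (mass (\<lambda>k. Bs k \<omega>) n (\<Gamma> n \<omega>)) / ereal (real n))"
    using growth_along_path[OF assms] by blast
  then show ?thesis
  proof eventually_elim
    case (elim \<omega>)
    have "liminf (\<lambda>n. log_ennreal (mass (\<lambda>k. Bs k \<omega>) n (\<Gamma> n \<omega>)) / ereal (real n))
        \<le> liminf (\<lambda>n. log_ennreal (total_mass (\<lambda>k. Bs k \<omega>) n) / ereal (real n))"
    proof (rule Liminf_mono, rule eventually_mono[OF eventually_gt_at_top[of 0]])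
      fix n :: nat assume "0 < n"
      moreover have "mass (\<lambda>k. Bs k \<omega>) n (\<Gamma> n \<omega>) \<le> total_mass (\<lambda>k. Bs k \<omega>) n"
        unfolding total_mass_def by (rule nn_integral_ge_point) simp
      ultimately show "log_ennreal (mass (\<lambda>k. Bs k \<omega>) n (\<Gamma> n \<omega>)) / ereal (real n)
          \<le> log_ennreal (total_mass (\<lambda>k. Bs k \<omega>) n) / ereal (real n)"
        by (intro ereal_divide_right_mono log_ennreal_mono) auto
    qed
    with elim show ?case by (auto intro: order_trans)
  qed
qed

end

section \<open>Absence of growth\<close>

text \<open>One half of the equivalence of norms: \<open>N\<close> is Lipschitz for the Euclidean
  norm, hence attains a positive minimum on the compact unit sphere, and \<open>K\<close> is the
  reciprocal of that minimum.\<close>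

lemma norm_on_Rd_component_bound:
  fixes N :: "real ^ ('d::finite) \<Rightarrow> real"
  assumes "norm_on_Rd N"
  shows "\<exists>K>0. \<forall>u i. \<bar>u $ i\<bar> \<le> K * N u"
proof -
  have N_eq_0: "N u = 0 \<longleftrightarrow> u = 0" and scale: "N (a *\<^sub>R u) = \<bar>a\<bar> * N u"
    and tri: "N (u + v) \<le> N u + N v" for u v a
    using assms by (auto simp: norm_on_Rd_def)
  have neg: "N (- u) = N u" for u
    using scale[of "-1" u] by simp
  have nonneg: "0 \<le> N u" for u
    using tri[of u "- u"] neg[of u] N_eq_0[of 0] by simp
  define C where "C = (\<Sum>b\<in>Basis. N (b :: real ^ 'd))"
  have le_C: "N u \<le> C * norm u" for u
  proof -
    have "N (\<Sum>b\<in>A. (u \<bullet> b) *\<^sub>R b) \<le> (\<Sum>b\<in>A. \<bar>u \<bullet> b\<bar> * N b)" if "finite A" for A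
      using that
    proof (induction A)
      case (insert b A)
      then show ?case
        using tri[of "(u \<bullet> b) *\<^sub>R b" "\<Sum>b\<in>A. (u \<bullet> b) *\<^sub>R b"] by (simp add: scale)
    qed (simp add: N_eq_0[THEN iffD2])
    from this[of Basis] have "N u \<le> (\<Sum>b\<in>Basis. \<bar>u \<bullet> b\<bar> * N b)"
      by (simp add: euclidean_representation)
    also have "\<dots> \<le> (\<Sum>b\<in>Basis. norm u * N b)"
      by (intro sum_mono mult_right_mono Basis_le_norm nonneg)
    finally show ?thesis by (simp add: C_def sum_distrib_left mult.commute)
  qed
  have "continuous_on (sphere 0 1) N"
  proof (rule continuous_on_subset[OF _ subset_UNIV])
    have "\<bar>N u - N v\<bar> \<le> C * norm (u - v)" for u v
      using tri[of "u - v" v] tri[of "v - u" u] le_C[of "u - v"] neg[of "u - v"] by simp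
    moreover have "0 \<le> C" unfolding C_def by (intro sum_nonneg nonneg)
    ultimately have "C-lipschitz_on UNIV N"
      by (intro lipschitz_onI) (auto simp: dist_norm)
    then show "continuous_on UNIV N" by (rule lipschitz_on_continuous_on)
  qed
  moreover have "axis undefined 1 \<in> sphere (0 :: real ^ 'd) 1" by simp
  then have "sphere (0 :: real ^ 'd) 1 \<noteq> {}" by blast
  ultimately obtain w where w: "w \<in> sphere 0 1" "\<And>u. u \<in> sphere 0 1 \<Longrightarrow> N w \<le> N u"
    using continuous_attains_inf[of "sphere (0 :: real ^ 'd) 1" N] by auto
  have "0 < N w"
    using w(1) nonneg[of w] N_eq_0[of w] by (auto simp: less_le)
  moreover have "\<bar>u $ i\<bar> \<le> 1 / N w * N u" for u i
  proof (cases "u = 0")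
    case False
    then have "N w \<le> N ((1 / norm u) *\<^sub>R u)"
      by (intro w(2)) simp
    then have "norm u \<le> 1 / N w * N u"
      using False \<open>0 < N w\<close> by (simp add: scale field_simps)
    then show ?thesis using component_le_norm_cart[of u i] by linarith
  qed (simp add: N_eq_0[THEN iffD2])
  ultimately show ?thesis by (intro exI[of _ "1 / N w"]) simp
qed

lemma card_lattice_box:
  fixes R :: nat
  shows "finite {x :: ('d::finite) lattice. \<forall>i. \<bar>x $ i\<bar> \<le> int R}"
    and "card {x :: ('d::finite) lattice. \<forall>i. \<bar>x $ i\<bar> \<le> int R} \<le> (2 * R + 1) ^ CARD('d)"
proof -
  let ?F = "\<Pi>\<^sub>E i\<in>(UNIV :: 'd set). {- int R..int R}"
  have eq: "{x :: 'd lattice. \<forall>i. \<bar>x $ i\<bar> \<le> int R} = vec_lambda ` ?F"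
  proof (intro equalityI subsetI)
    fix x :: "'d lattice" assume "x \<in> {x. \<forall>i. \<bar>x $ i\<bar> \<le> int R}"
    then have "vec_nth x \<in> ?F" by (auto simp: abs_le_iff minus_le_iff)
    then show "x \<in> vec_lambda ` ?F" by (intro image_eqI[of _ _ "vec_nth x"]) simp_all
  qed (auto simp: PiE_iff abs_le_iff minus_le_iff)
  have fin: "finite ?F" by (intro finite_PiE) auto
  then show "finite {x :: 'd lattice. \<forall>i. \<bar>x $ i\<bar> \<le> int R}"
    unfolding eq by (rule finite_imageI)
  have "card ?F = (2 * R + 1) ^ CARD('d)"
  proof -
    have "card {- int R..int R} = 2 * R + 1" by (simp add: nat_eq_iff)
    then show ?thesis by (simp add: card_PiE)
  qed
  then show "card {x :: 'd lattice. \<forall>i. \<bar>x $ i\<bar> \<le> int R} \<le> (2 * R + 1) ^ CARD('d)"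
    unfolding eq using card_image_le[OF fin, of vec_lambda] by simp
qed

lemma mass_support:
  assumes range: "\<And>n x y i. 1 \<le> n \<Longrightarrow> b n (x, y) \<noteq> 0 \<Longrightarrow> \<bar>x $ i - y $ i\<bar> \<le> int K"
    and "mass b n x \<noteq> 0"
  shows "\<bar>x $ i\<bar> \<le> int (n * K)"
  using assms(2)
proof (induction n arbitrary: x)
  case 0
  then show ?case by (simp split: if_splits)
next
  case (Suc n)
  have "\<exists>y. mass b n y * b (Suc n) (y, x) \<noteq> 0"
  proof (rule ccontr)
    assume "\<nexists>y. mass b n y * b (Suc n) (y, x) \<noteq> 0"
    then have "(\<lambda>y. mass b n y * b (Suc n) (y, x)) = (\<lambda>_. 0)" by blast
    then show False using Suc.prems by (simp del: mult_eq_0_iff)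
  qed
  then obtain y where y: "mass b n y \<noteq> 0" "b (Suc n) (y, x) \<noteq> 0" by auto
  have "\<bar>y $ i\<bar> \<le> int (n * K)" by (rule Suc.IH[OF y(1)])
  moreover have "\<bar>y $ i - x $ i\<bar> \<le> int K" by (rule range[OF _ y(2)]) simp
  ultimately show ?case by (simp add: algebra_simps)
qed

lemma total_mass_le_box:
  fixes b :: "nat \<Rightarrow> ('d::finite) lmatrix"
  assumes range: "\<And>n x y i. 1 \<le> n \<Longrightarrow> b n (x, y) \<noteq> 0 \<Longrightarrow> \<bar>x $ i - y $ i\<bar> \<le> int K"
    and le: "\<And>x. mass b n x \<le> 1"
  shows "total_mass b n \<le> ennreal ((2 * (real n * real K) + 1) ^ CARD('d))"
proof -
  let ?box = "{x :: 'd lattice. \<forall>i. \<bar>x $ i\<bar> \<le> int (n * K)}"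
  have "mass b n x \<le> indicator ?box x" for x
  proof (cases "mass b n x = 0")
    case False
    have "\<bar>x $ i\<bar> \<le> int (n * K)" for i
      by (rule mass_support[of b]) (fact range False)+
    then have "x \<in> ?box" by blast
    then show ?thesis using le[of x] by simp
  qed simp
  then have "total_mass b n \<le> (\<integral>\<^sup>+ x. indicator ?box x \<partial>count_space UNIV)"
    unfolding total_mass_def by (intro nn_integral_mono)
  also have "\<dots> = of_nat (card ?box)"
    using card_lattice_box(1)[of "n * K"] by (simp add: emeasure_count_space)
  also have "\<dots> \<le> of_nat ((2 * (n * K) + 1) ^ CARD('d))"
    by (intro of_nat_mono card_lattice_box(2))
  also have "\<dots> = ennreal (real ((2 * (n * K) + 1) ^ CARD('d)))"
    by (simp only: ennreal_of_nat_eq_real_of_nat)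
  finally show ?thesis by (simp add: add.commute)
qed

lemma limsup_log_polynomial:
  assumes "\<And>n. 1 \<le> n \<Longrightarrow> u n \<le> ennreal ((2 * (real n * real K) + 1) ^ d)"
  shows "limsup (\<lambda>n. log_ennreal (u n) / ereal (real n)) \<le> 0"
proof -
  let ?v = "\<lambda>n. real d * (ln (2 * real K + 1) * inverse (real n) + ln (real n) / real n)"
  have "?v \<longlonglongrightarrow> real d * (ln (2 * real K + 1) * 0 + 0)"
    by (intro tendsto_intros lim_inverse_n lim_ln_over_n)
  then have "(\<lambda>n. ereal (?v n)) \<longlonglongrightarrow> 0"
    by (simp add: zero_ereal_def)
  then have "limsup (\<lambda>n. ereal (?v n)) = 0"
    by (intro lim_imp_Limsup) auto
  moreover have "limsup (\<lambda>n. log_ennreal (u n) / ereal (real n)) \<le> limsup (\<lambda>n. ereal (?v n))"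
  proof (rule Limsup_mono, rule eventually_mono[OF eventually_gt_at_top[of 0]])
    fix n :: nat assume n: "0 < n"
    have "log_ennreal (u n) \<le> log_ennreal (ennreal ((2 * (real n * real K) + 1) ^ d))"
      using assms n by (intro log_ennreal_mono) simp
    also have "\<dots> = ereal (real d * ln (2 * (real n * real K) + 1))"
    proof -
      have "0 < 2 * (real n * real K) + 1" by (simp add: add_nonneg_pos)
      then show ?thesis by (simp add: log_ennreal_ennreal ln_realpow del: ennreal_plus)
    qed
    also have "\<dots> \<le> ereal (real d * (ln (2 * real K + 1) + ln (real n)))"
    proof -
      have "2 * (real n * real K) + 1 \<le> (2 * real K + 1) * real n"
        using n by (simp add: algebra_simps)
      moreover have pos: "0 < 2 * (real n * real K) + 1" "0 < 2 * real K + 1"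
        by (simp_all add: add_nonneg_pos)
      ultimately have "ln (2 * (real n * real K) + 1) \<le> ln ((2 * real K + 1) * real n)"
        using n by (subst ln_le_cancel_iff) auto
      also have "\<dots> = ln (2 * real K + 1) + ln (real n)"
        using n pos by (intro ln_mult_pos) auto
      finally show ?thesis by (simp add: mult_left_mono)
    qed
    finally have "log_ennreal (u n) / ereal (real n)
        \<le> ereal (real d * (ln (2 * real K + 1) + ln (real n))) / ereal (real n)"
      using n by (intro ereal_divide_right_mono) auto
    also have "\<dots> = ereal (?v n)"
      using n by (simp add: field_simps)
    finally show "log_ennreal (u n) / ereal (real n) \<le> ereal (?v n)" .
  qed
  ultimately show ?thesis by simp
qed

context matrix_products
begin

lemma no_growth:
  assumes c: "\<And>\<delta> m. 0 < \<delta> \<Longrightarrow> 1 \<le> m \<Longrightarrow> c_delta \<delta> (prod_law P Bs m) = 0"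
    and N: "norm_on_Rd N" and r: "0 < r"
    and range: "AE b in L. \<forall>x y. r \<le> lattice_dist N x y \<longrightarrow> b (x, y) = 0"
  shows "AE \<omega> in P. limsup (\<lambda>n. log_ennreal (total_mass (\<lambda>k. Bs k \<omega>) n) / ereal (real n)) \<le> 0"
proof (cases "surv_probability = 0")
  case True
  from AE_not_survives[OF this] AE_zero_or_ge_1 show ?thesis
  proof eventually_elim
    case (elim \<omega>)
    then obtain n0 where n0: "\<not> 1 \<le> total_mass (\<lambda>k. Bs k \<omega>) n0"
      by (auto simp: survives_def)
    have z: "zero_or_ge_1 (\<lambda>k. Bs k \<omega>)" using elim by simp
    have zero: "total_mass (\<lambda>k. Bs k \<omega>) n = 0" if "n0 \<le> n" for n
      using n0 alive_mono[OF that] unfolding total_mass_ge_1_iff_alive[OF z] by blast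
    have "limsup (\<lambda>n. log_ennreal (total_mass (\<lambda>k. Bs k \<omega>) n) / ereal (real n)) \<le> limsup (\<lambda>n. - \<infinity>)"
    proof (rule Limsup_mono, rule eventually_mono[OF eventually_gt_at_top[of n0]])
      fix n assume "n0 < n"
      then show "log_ennreal (total_mass (\<lambda>k. Bs k \<omega>) n) / ereal (real n) \<le> - \<infinity>"
        using zero[of n] by (simp add: log_ennreal_def)
    qed
    also have "\<dots> = - \<infinity>"
      by (rule Limsup_const) simp
    finally show ?case by simp
  qed
next
  case False
  \<comment> \<open>With a positive survival probability, \<open>c_delta = 0\<close> forces the
    supremum in it to vanish, and with it the probability for each single site. The thresholds
    \<open>1 + 1 / Suc j\<close> decrease to 1 along a countable sequence, so almost surely all
    entries in row 0 of all products are at most 1.\<close>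
  have "AE \<omega> in P. mat_prod (\<lambda>k. Bs k \<omega>) m (0, x) < ennreal (1 + 1 / real (Suc j))"
    if m: "1 \<le> m" for m x and j :: nat
  proof -
    let ?\<nu> = "prod_law P Bs m" and ?\<delta> = "1 / real (Suc j)"
    interpret \<nu>: prob_space ?\<nu> by (rule prob_space_prod_law)
    have sup: "(SUP x. measure ?\<nu> {D. ennreal (1 + ?\<delta>) \<le> D (0, x)}) = 0"
      using c[of ?\<delta> m] False m by (simp add: c_delta_prod_law)
    have "measure ?\<nu> {D. ennreal (1 + ?\<delta>) \<le> D (0, x)} \<le> (SUP x. measure ?\<nu> {D. ennreal (1 + ?\<delta>) \<le> D (0, x)})"
      by (intro cSUP_upper bdd_aboveI2[of _ _ 1]) auto
    then have "measure ?\<nu> {D. ennreal (1 + ?\<delta>) \<le> D (0, x)} = 0"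
      unfolding sup by (simp add: antisym)
    moreover have "Measurable.pred matrix_space (\<lambda>D. ennreal (1 + ?\<delta>) \<le> D (0, x))"
      by measurable
    then have "{D. ennreal (1 + ?\<delta>) \<le> D (0, x)} \<in> sets ?\<nu>"
      by (simp add: pred_def)
    ultimately have "{D. ennreal (1 + ?\<delta>) \<le> D (0, x)} \<in> null_sets ?\<nu>"
      by (simp add: null_sets_def \<nu>.emeasure_eq_measure)
    then have "AE D in ?\<nu>. D \<notin> {D. ennreal (1 + ?\<delta>) \<le> D (0, x)}"
      by (rule AE_not_in)
    then have "AE D in distr P matrix_space (\<lambda>\<omega>. mat_prod (\<lambda>n. Bs n \<omega>) m). D (0, x) < ennreal (1 + ?\<delta>)"
      unfolding prod_law_def by eventually_elim (simp add: not_le)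
    then show ?thesis
      by (rule AE_distrD[rotated]) (rule mat_prod_measurable, simp)
  qed
  then have "AE \<omega> in P. 1 \<le> m \<longrightarrow> mat_prod (\<lambda>k. Bs k \<omega>) m (0, x) < ennreal (1 + 1 / real (Suc j))" for m x j
    by (cases "1 \<le> m") auto
  then have small: "AE \<omega> in P. \<forall>m x (j::nat). 1 \<le> m \<longrightarrow> mat_prod (\<lambda>k. Bs k \<omega>) m (0, x) < ennreal (1 + 1 / real (Suc j))"
    unfolding AE_all_countable by blast
  have "AE \<omega> in P. 1 \<le> n \<longrightarrow> (\<forall>x y. r \<le> lattice_dist N x y \<longrightarrow> Bs n \<omega> (x, y) = 0)" for n
    using AE_Bs[OF _ range, of n] by (cases "1 \<le> n") auto
  then have "AE \<omega> in P. \<forall>n. 1 \<le> n \<longrightarrow> (\<forall>x y. r \<le> lattice_dist N x y \<longrightarrow> Bs n \<omega> (x, y) = 0)"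
    unfolding AE_all_countable by blast
  note range_AE = this
  \<comment> \<open>\<open>K'\<close> turns the range \<open>r\<close>, measured by
    \<open>N\<close>, into a bound on coordinates; rounded up to \<open>K\<close>, it is the growth
    per step of the box containing the mass.\<close>
  obtain K' where K': "0 < K'" "\<And>u i. \<bar>u $ i\<bar> \<le> K' * N u"
    using norm_on_Rd_component_bound[OF N] by blast
  obtain K :: nat where K: "K' * r \<le> real K"
    using real_arch_simple by blast
  from range_AE small show ?thesis
  proof eventually_elim
    case (elim \<omega>)
    have range: "\<bar>x $ i - y $ i\<bar> \<le> int K" if "1 \<le> n" "Bs n \<omega> (x, y) \<noteq> 0" for n x y i
    proof -
      have "lattice_dist N x y < r" using elim that by force
      then have "K' * N (\<chi> i. real_of_int (x $ i - y $ i)) \<le> K' * r"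
        using K'(1) by (simp add: lattice_dist_def)
      then have "\<bar>real_of_int (x $ i - y $ i)\<bar> \<le> real K"
        using K'(2)[of "\<chi> i. real_of_int (x $ i - y $ i)" i] K by simp
      then show ?thesis by linarith
    qed
    have "mass (\<lambda>k. Bs k \<omega>) n x \<le> 1" if "1 \<le> n" for n x
    proof -
      have "(\<lambda>j. ennreal (1 + 1 / real (Suc j))) \<longlonglongrightarrow> ennreal (1 + 0)"
        by (intro tendsto_ennrealI tendsto_add tendsto_const LIMSEQ_inverse_real_of_nat[unfolded inverse_eq_divide])
      then have "mat_prod (\<lambda>k. Bs k \<omega>) n (0, x) \<le> ennreal (1 + 0)"
      proof (rule LIMSEQ_le_const)
        show "\<exists>j0. \<forall>j\<ge>j0. mat_prod (\<lambda>k. Bs k \<omega>) n (0, x) \<le> ennreal (1 + 1 / real (Suc j))"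
          using elim(2) that by (intro exI[of _ 0] allI impI less_imp_le) blast
      qed
      then show ?thesis by (simp add: mass_eq_mat_prod)
    qed
    then have "total_mass (\<lambda>k. Bs k \<omega>) n \<le> ennreal ((2 * (real n * real K) + 1) ^ CARD('d))" if "1 \<le> n" for n
      using that range by (intro total_mass_le_box) auto
    then show ?case by (rule limsup_log_polynomial)
  qed
qed

end

theorem corollary1p3:
  fixes Q :: "'v measure" and B :: "'v \<Rightarrow> ('d::finite) lmatrix"
    and P :: "'w measure" and Bs :: "nat \<Rightarrow> 'w \<Rightarrow> 'd lmatrix"
    and N :: "real ^ 'd \<Rightarrow> real"
  assumes "prob_space Q" and "prob_space P" and "norm_on_Rd N"
    and "B \<in> measurable Q matrix_space"
    and "AE \<omega> in Q. \<forall>p. B \<omega> p = 0 \<or> (1 \<le> B \<omega> p \<and> B \<omega> p < \<infinity>)"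
    and "translation_invariant Q B"
    and "prob_space.indep_vars P (\<lambda>_. matrix_space) Bs {1..}"
    and "\<And>n. 1 \<le> n \<Longrightarrow> distr P matrix_space (Bs n) = distr Q matrix_space B"
  shows
    "(\<forall>\<delta>>0. \<forall>m\<ge>1. c_delta \<delta> (prod_law P Bs m) > 0 \<longrightarrow>
        (\<forall>\<epsilon>. 0 < \<epsilon> \<and> \<epsilon> < \<delta> \<longrightarrow>
          (\<exists>\<Gamma> :: nat \<Rightarrow> 'w \<Rightarrow> 'd lattice.
            (\<forall>n. \<Gamma> n \<in> measurable P (count_space UNIV)) \<and>
            (AE \<omega> in P. survives (\<lambda>n. Bs n \<omega>) \<longrightarrow>
               open_path (\<lambda>n. Bs n \<omega>) (\<lambda>n. \<Gamma> n \<omega>) \<and>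
               liminf (\<lambda>n. log_ennreal (mass (\<lambda>k. Bs k \<omega>) n (\<Gamma> n \<omega>)) / ereal (real n))
                 \<ge> ereal (1 / real m * c_delta (\<delta> - \<epsilon>) (prod_law P Bs m) * ln (1 + \<delta> - \<epsilon>)))))
        \<and>
        (AE \<omega> in P. survives (\<lambda>n. Bs n \<omega>) \<longrightarrow>
           liminf (\<lambda>n. log_ennreal (total_mass (\<lambda>k. Bs k \<omega>) n) / ereal (real n))
             \<ge> ereal (1 / real m * c_delta \<delta> (prod_law P Bs m) * ln (1 + \<delta>))))
     \<and>
     ((\<forall>\<delta>>0. \<forall>m\<ge>1. c_delta \<delta> (prod_law P Bs m) = 0) \<and>
      (\<exists>r>0. AE \<omega> in Q. \<forall>x y. r \<le> lattice_dist N x y \<longrightarrow> B \<omega> (x, y) = 0) \<longrightarrow>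
        (AE \<omega> in P.
           limsup (\<lambda>n. log_ennreal (total_mass (\<lambda>k. Bs k \<omega>) n) / ereal (real n)) \<le> 0))"
proof -
  have law_AE: "AE b in distr Q matrix_space B. A b"
    if "Measurable.pred matrix_space A" "AE \<omega> in Q. A (B \<omega>)" for A
    using that AE_distr_iff[OF assms(4), of A] by (simp add: pred_def)
  interpret matrix_products P Bs "distr Q matrix_space B"
  proof (intro matrix_products.intro matrix_products_axioms.intro)
    show "distr (distr Q matrix_space B) matrix_space (translate z) = distr Q matrix_space B" for z
      using assms(6) by (simp add: distr_distr[OF translate_measurable assms(4)] comp_def translation_invariant_def)
    show "AE b in distr Q matrix_space B. \<forall>p. b p = 0 \<or> (1 \<le> b p \<and> b p < \<infinity>)"
      by (rule law_AE[OF _ assms(5)]) measurable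
  qed (use assms in auto)
  show ?thesis
  proof (intro conjI allI impI)
    fix \<delta> \<epsilon> :: real and m :: nat
    assume "1 \<le> m" "0 < \<epsilon> \<and> \<epsilon> < \<delta>"
    then show "\<exists>\<Gamma> :: nat \<Rightarrow> 'w \<Rightarrow> 'd lattice.
        (\<forall>n. \<Gamma> n \<in> measurable P (count_space UNIV)) \<and>
        (AE \<omega> in P. survives (\<lambda>n. Bs n \<omega>) \<longrightarrow>
           open_path (\<lambda>n. Bs n \<omega>) (\<lambda>n. \<Gamma> n \<omega>) \<and>
           liminf (\<lambda>n. log_ennreal (mass (\<lambda>k. Bs k \<omega>) n (\<Gamma> n \<omega>)) / ereal (real n))
             \<ge> ereal (1 / real m * c_delta (\<delta> - \<epsilon>) (prod_law P Bs m) * ln (1 + \<delta> - \<epsilon>)))"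
      using growth_along_path[of "\<delta> - \<epsilon>" m] by (simp only: diff_gt_0_iff_gt add_diff_eq)
  next
    fix \<delta> :: real and m :: nat
    assume "0 < \<delta>" "1 \<le> m"
    then show "AE \<omega> in P. survives (\<lambda>n. Bs n \<omega>) \<longrightarrow>
        liminf (\<lambda>n. log_ennreal (total_mass (\<lambda>k. Bs k \<omega>) n) / ereal (real n))
          \<ge> ereal (1 / real m * c_delta \<delta> (prod_law P Bs m) * ln (1 + \<delta>))"
      by (rule growth_total_mass)
  next
    assume *: "(\<forall>\<delta>>0. \<forall>m\<ge>1. c_delta \<delta> (prod_law P Bs m) = 0) \<and>
      (\<exists>r>0. AE \<omega> in Q. \<forall>x y. r \<le> lattice_dist N x y \<longrightarrow> B \<omega> (x, y) = 0)"
    then obtain r where r: "0 < r" "AE \<omega> in Q. \<forall>x y. r \<le> lattice_dist N x y \<longrightarrow> B \<omega> (x, y) = 0"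
      by blast
    show "AE \<omega> in P. limsup (\<lambda>n. log_ennreal (total_mass (\<lambda>k. Bs k \<omega>) n) / ereal (real n)) \<le> 0"
    proof (rule no_growth[OF _ assms(3) r(1)])
      show "AE b in distr Q matrix_space B. \<forall>x y. r \<le> lattice_dist N x y \<longrightarrow> b (x, y) = 0"
        by (rule law_AE[OF _ r(2)]) measurable
    qed (use * in blast)
  qed
qed

end
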